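(* Let $k=3$ on the reference equilateral triangle, with the Dubiner basis $\phi_1,\dots,\phi_{10}$. The $10\times10$ modal matrix $\tilde{\mathbf Q}$ satisfying the extended-range conditions (E1)–(E3) of the context is, with free parameters $q_0,q_1,q_2\in\mathbb R$, the symmetric matrix whose only (possibly) nonzero entries are, up to symmetry, $$\tilde Q_{4,4}=\tfrac{q_1+4q_0}{5}+q_2\sqrt{\tfrac{48}{175}},\quad \tilde Q_{4,9}=\tfrac{q_0-q_1}{\sqrt5}+q_2\sqrt{\tfrac{3}{35}},\quad \tilde Q_{9,9}=q_1,$$ $$\tilde Q_{7,7}=q_0-q_2\sqrt{\tfrac{16}{21}},\quad \tilde Q_{7,10}=q_2,\quad \tilde Q_{10,10}=q_0 .$$ The stability limits (positive definiteness of $\tilde{\mathbf M}+\tilde{\mathbf Q}$) are $$28q_0+7q_1+4\sqrt{21}q_2>-35,\qquad 21q_0-4\sqrt{21}q_2>-21,$$ $$(7q_0+\sqrt{21}q_2+7)(7q_0-42q_1+\sqrt{21}q_2-35)<0,\qquad (7q_0+\sqrt{21}q_2+7)(3q_0-\sqrt{21}q_2+3)>0 .$$ The single-parameter scheme of Castonguay et al., given by the matrix $\tilde{\mathbf Q}_{\mathrm C}$ of the context, is recovered with $$q_0=6384c,\qquad q_1=\frac{27440c}{3},\qquad q_2=-168\sqrt{21}c,$$ subject to the stability condition $c>-\tfrac1{9800}$.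
   Context: Reference triangle $\hat K$: vertices $(-1,-1/\sqrt3)$, $(1,-1/\sqrt3)$, $(0,2/\sqrt3)$. Dubiner basis of polynomials of total degree $\le k$: $$\phi_i(x,y)=\frac{2}{3^{1/4}}(1-b)^v\psi_v^{(0,0)}(a)\,\psi_w^{(2v+1,0)}(b),\quad a=\frac{3x}{2-\sqrt3y},\quad b=\frac{2\sqrt3y-1}{3},$$ where $v,w\ge0$ are integers with $v+w\le k$ and $0=v^2-(2k+3)v-2(w-i+1)$, i.e. $i=w+1+v(2k+3-v)/2$ (indices start at 1). Here $\psi_n^{(\alpha,\beta)}$ is the normalised Jacobi polynomial (unit norm in $L^2([-1,1],(1-s)^\alpha(1+s)^\beta\mathrm ds)$). The modal mass matrix $\tilde{\mathbf M}$, with entries $\int_{\hat K}\phi_i\phi_j\,\mathrm d\mathbf x$, is the identity. $\tilde{\mathbf D}_x,\tilde{\mathbf D}_y$ are the matrices of $\partial_x,\partial_y$ in this basis. Extended-range conditions on $\tilde{\mathbf Q}$: (E1) $\tilde{\mathbf Q}=\tilde{\mathbf Q}^T$; (E2) $\tilde{\mathbf Q}\tilde{\mathbf D}_x+\tilde{\mathbf D}_x^T\tilde{\mathbf Q}^T=0$ and $\tilde{\mathbf Q}\tilde{\mathbf D}_y+\tilde{\mathbf D}_y^T\tilde{\mathbf Q}^T=0$; (E3) symmetry: $\tilde{\mathbf Q}$ commutes with the matrix (in the basis $\phi_i$) of $f\mapsto f\circ R$ for the rotation $R$ by $2\pi/3$ about the centroid (the origin), and with the matrix of $f(x,y)\mapsto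 f(-x,y)$. Together with positive definiteness of $\tilde{\mathbf M}+\tilde{\mathbf Q}$, these define the extended range of linearly stable flux reconstruction (FR) schemes, with correction matrix $\tilde{\mathbf C}=(\tilde{\mathbf M}+\tilde{\mathbf Q})^{-1}\tilde{\mathbf L}_\partial^T\mathbf W_\partial$, where $\tilde{\mathbf L}_\partial$ evaluates the modes at the boundary flux points and $\mathbf W_\partial$ is the diagonal matrix of non-negative surface quadrature weights. Single-parameter scheme (Castonguay et al.): FR with this total order basis is stable in the broken Sobolev norm $$\frac12\int_{\hat K}u^2+\frac cA\sum_{m=1}^{k+1}\binom{k}{m-1}\big(D^{m,k}u\big)^2\,\mathrm d\mathbf x,\qquad D^{m,k}=\frac{\partial^k}{\partial x^{k-m+1}\partial y^{m-1}},\qquad A=|\hat K|,$$ and correspondingly $$\tilde{\mathbf Q}_{\mathrm C}=\frac cA\sum_{m=1}^{k+1}\binom{k}{m-1}(\tilde{\mathbf K}^{m,k})^T\tilde{\mathbf M}\tilde{\mathbf K}^{m,k},\qquad \tilde{\mathbf K}^{m,k}=\tilde{\mathbf D}_x^{\,k-m+1}\tilde{\mathbf D}_y^{\,m-1}.$$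
   Formalization: With the prefactor c/A (A = √3) in Q_C, the printed values of q0, q1, q2 and the bound −1/9800 are false for c ≠ 0 (entry (10,10) is 6384c/√3); the formal theorem states them with c/A in place of c. *)

theory Defs
  imports "HOL-Analysis.Analysis" "Jordan_Normal_Form.Matrix"
begin

section \<open>Reference triangle\<close>

definition ref_triangle :: "(real \<times> real) set" where
  "ref_triangle = convex hull {(- 1, - 1 / sqrt 3), (1, - 1 / sqrt 3), (0, 2 / sqrt 3)}"

definition ref_area :: real where
  "ref_area = measure lebesgue ref_triangle"


section \<open>Normalised Jacobi polynomials\<close>

text \<open>The classical Jacobi polynomial for natural number parameters (only these occur in the
  Dubiner basis), in the standard convention \<open>P\<^sub>n(1) = (n + \<alpha>) choose n\<close>; in particular
  the leading coefficient is positive.\<close>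

definition jacobi :: "nat \<Rightarrow> nat \<Rightarrow> nat \<Rightarrow> real \<Rightarrow> real" where
  "jacobi n \<alpha> \<beta> s =
     (\<Sum>j\<le>n. real ((n + \<alpha>) choose (n - j)) * real ((n + \<beta>) choose j)
              * ((s - 1) / 2) ^ j * ((s + 1) / 2) ^ (n - j))"

definition normalised_jacobi :: "nat \<Rightarrow> nat \<Rightarrow> nat \<Rightarrow> real \<Rightarrow> real" where
  "normalised_jacobi n \<alpha> \<beta> s =
     jacobi n \<alpha> \<beta> s
       / sqrt (integral {-1..1} (\<lambda>t. (jacobi n \<alpha> \<beta> t)\<^sup>2 * (1 - t) ^ \<alpha> * (1 + t) ^ \<beta>))"


section \<open>Dubiner basis\<close>

definition num_modes :: "nat \<Rightarrow> nat" where
  "num_modes k = (k + 1) * (k + 2) div 2"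

text \<open>The pair \<open>(v, w)\<close> belonging to the mode number \<open>i\<close>, where \<open>1 \<le> i \<le> num_modes k\<close>.\<close>

definition dubiner_index :: "nat \<Rightarrow> nat \<Rightarrow> nat \<times> nat" where
  "dubiner_index k i =
     (THE (v, w). v + w \<le> k \<and>
        0 = (int v)\<^sup>2 - (2 * int k + 3) * int v - 2 * (int w - int i + 1))"

text \<open>As a formula this is singular on the line \<open>sqrt 3 * y = 2\<close>, which meets the reference
  triangle only in its top vertex. All pointwise identities below are therefore required on
  the interior of the triangle only; this determines the polynomials.\<close>

definition dubiner :: "nat \<Rightarrow> nat \<Rightarrow> real \<times> real \<Rightarrow> real" where
  "dubiner k i = (\<lambda>(x, y).
     let (v, w) = dubiner_index k i;
         a = 3 * x / (2 - sqrt 3 * y);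
         b = (2 * sqrt 3 * y - 1) / 3
     in 2 / root 4 3 * (1 - b) ^ v * normalised_jacobi v 0 0 a
          * normalised_jacobi w (2 * v + 1) 0 b)"


section \<open>Modal matrices\<close>

text \<open>The rows and columns of a matrix are numbered from 0, the modes from 1.\<close>

definition mass_matrix :: "nat \<Rightarrow> real mat" where
  "mass_matrix k = Matrix.mat (num_modes k) (num_modes k)
     (\<lambda>(i, j). integral ref_triangle (\<lambda>p. dubiner k (i + 1) p * dubiner k (j + 1) p))"

text \<open>The matrix of an operator on functions: column \<open>j\<close> holds the coefficients of the image
  of the mode \<open>j + 1\<close>, so that the matrix acts on vectors of modal coefficients.\<close>

definition modal_matrix ::
  "nat \<Rightarrow> ((real \<times> real \<Rightarrow> real) \<Rightarrow> (real \<times> real \<Rightarrow> real)) \<Rightarrow> real mat" where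
  "modal_matrix k T =
     (THE A. A \<in> carrier_mat (num_modes k) (num_modes k) \<and>
        (\<forall>j < num_modes k. \<forall>p \<in> interior ref_triangle.
           T (dubiner k (j + 1)) p = (\<Sum>i < num_modes k. A $$ (i, j) * dubiner k (i + 1) p)))"

definition partial_x :: "(real \<times> real \<Rightarrow> real) \<Rightarrow> (real \<times> real \<Rightarrow> real)" where
  "partial_x f = (\<lambda>(x, y). deriv (\<lambda>t. f (t, y)) x)"

definition partial_y :: "(real \<times> real \<Rightarrow> real) \<Rightarrow> (real \<times> real \<Rightarrow> real)" where
  "partial_y f = (\<lambda>(x, y). deriv (\<lambda>t. f (x, t)) y)"

definition rotation :: "real \<times> real \<Rightarrow> real \<times> real" where
  "rotation = (\<lambda>(x, y). (cos (2 * pi / 3) * x - sin (2 * pi / 3) * y,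
                          sin (2 * pi / 3) * x + cos (2 * pi / 3) * y))"

definition reflection :: "real \<times> real \<Rightarrow> real \<times> real" where
  "reflection = (\<lambda>(x, y). (- x, y))"

definition D_x :: "nat \<Rightarrow> real mat" where
  "D_x k = modal_matrix k partial_x"

definition D_y :: "nat \<Rightarrow> real mat" where
  "D_y k = modal_matrix k partial_y"

definition rotation_matrix :: "nat \<Rightarrow> real mat" where
  "rotation_matrix k = modal_matrix k (\<lambda>f. f \<circ> rotation)"

definition reflection_matrix :: "nat \<Rightarrow> real mat" where
  "reflection_matrix k = modal_matrix k (\<lambda>f. f \<circ> reflection)"


section \<open>Extended range and positive definiteness\<close>

definition extended_range_conditions :: "nat \<Rightarrow> real mat \<Rightarrow> bool" where
  "extended_range_conditions k Q \<longleftrightarrow>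
     Q = transpose_mat Q \<and>
     Q * D_x k + transpose_mat (D_x k) * transpose_mat Q = 0\<^sub>m (num_modes k) (num_modes k) \<and>
     Q * D_y k + transpose_mat (D_y k) * transpose_mat Q = 0\<^sub>m (num_modes k) (num_modes k) \<and>
     Q * rotation_matrix k = rotation_matrix k * Q \<and>
     Q * reflection_matrix k = reflection_matrix k * Q"

definition positive_definite :: "real mat \<Rightarrow> bool" where
  "positive_definite A \<longleftrightarrow>
     square_mat A \<and> transpose_mat A = A \<and>
     (\<forall>u \<in> carrier_vec (dim_row A). u \<noteq> 0\<^sub>v (dim_row A) \<longrightarrow> scalar_prod u (A *\<^sub>v u) > 0)"


section \<open>The single-parameter scheme of Castonguay et al.\<close>

definition K_matrix :: "nat \<Rightarrow> nat \<Rightarrow> real mat" where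
  "K_matrix k m = D_x k ^\<^sub>m (k + 1 - m) * D_y k ^\<^sub>m (m - 1)"

text \<open>With \<open>ref_area = sqrt 3\<close> and an orthonormal basis, this matrix has the bottom right entry
  \<open>6384 * (c / ref_area)\<close> for \<open>k = 3\<close>. The published constants \<open>6384 c\<close>, \<open>27440 c / 3\<close>,
  \<open>- 168 sqrt 21 c\<close> and the bound \<open>- 1 / 9800\<close> thus refer to the factor \<open>c / ref_area\<close> in front
  of the sum, and are attached to that number in the theorem.\<close>

definition Q_Castonguay :: "nat \<Rightarrow> real \<Rightarrow> real mat" where
  "Q_Castonguay k c = Matrix.mat (num_modes k) (num_modes k) (\<lambda>ij.
     c / ref_area * (\<Sum>m = 1..k + 1. real (k choose (m - 1))
        * (transpose_mat (K_matrix k m) * mass_matrix k * K_matrix k m) $$ ij))"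


section \<open>The three-parameter family of degree 3\<close>

definition Q_family :: "real \<Rightarrow> real \<Rightarrow> real \<Rightarrow> real mat" where
  "Q_family q0 q1 q2 = Matrix.mat 10 10 (\<lambda>(r, s).
     let ij = (r + 1, s + 1) in
     if ij = (4, 4) then (q1 + 4 * q0) / 5 + q2 * sqrt (48 / 175)
     else if ij = (4, 9) \<or> ij = (9, 4) then (q0 - q1) / sqrt 5 + q2 * sqrt (3 / 35)
     else if ij = (9, 9) then q1
     else if ij = (7, 7) then q0 - q2 * sqrt (16 / 21)
     else if ij = (7, 10) \<or> ij = (10, 7) then q2
     else if ij = (10, 10) then q0
     else 0)"

end

(*
  Write t = (2 - sqrt 3 * y) / 3, so that the triangle is |x| <= t <= 1, the collapsed coordinates are
  a = x / t and b = 1 - 2 * t, and x^a * t^b has an elementary integral over the triangle. In (x, t)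
  each mode for k = 3 is a square root of a rational number, times 3^(-1/4), times a polynomial
  with rational coefficients; conjugating by the diagonal matrix of these factors makes the matrices of
  differentiation (up to one factor 1 / sqrt 3) and of the two symmetries rational. Skew-symmetry with
  respect to both derivatives pushes the form Q up to the modes of degree 3 one entry at a time, and the
  two symmetries leave three parameters. The remaining matrix splits into two blocks of size 2, whose leading
  minors are the stability limits. For the single-parameter scheme, a third derivative of a mode is a
  multiple of the constant mode, so each term of the sum has rank one.
*)
theory Submission
  imports Defs
begin

section \<open>Integration over the reference triangle\<close>

text \<open>The formula of a mode is irrational and singular at the top vertex, and each modal
  matrix is a definite description; hence polynomials in \<open>x\<close> and \<open>t\<close>, with
  independence of the modes for uniqueness. An operator picks up
  \<open>mode_scale j / mode_scale i\<close>, a form \<open>mode_scale i * mode_scale j\<close>: in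
  every condition the scales then cancel or occur squared. Three parameters remain because the
  degree 3 modes carry the action of the symmetry group of the triangle on cubics modulo quadratics,
  spanned by the real and imaginary parts of z^3 and of z^2 times the conjugate of z, where z = x +
  iy. The trivial, the sign and the two-dimensional representation each occur once, and an invariant
  symmetric form is a scalar on each. With \<open>s = sqrt 21 * q2\<close> these eigenvalues are
  \<open>(42 * q1 - 7 * q0 - s) / 35\<close>, \<open>q0 - s / 3\<close> and, twice,
  \<open>q0 + s / 7\<close>. The reflection puts one copy of the double eigenvalue into each block,
  so both determinants share the factor \<open>7 * q0 + s + 7\<close>. For the single-parameter
  scheme they are 9800, 7560 and 5880 times \<open>c / ref_area\<close>; the largest gives the
  bound.\<close>

definition height :: "real \<Rightarrow> real" where
  "height y = (2 - sqrt 3 * y) / 3"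

text \<open>Barycentric coordinates: \<open>(height y - x) / 2\<close> and
  \<open>(height y + x) / 2\<close> are the weights of the two lower vertices and
  \<open>1 - height y\<close> that of the top, so \<open>height\<close> is 1 on the base and 0 at
  the top.\<close>

lemma ref_triangle_eq:
  "ref_triangle = {(x, y). \<bar>x\<bar> \<le> height y \<and> height y \<le> 1}"
proof (intro equalityI subsetI)
  fix p assume "p \<in> ref_triangle"
  then obtain u v w where uvw: "0 \<le> u" "0 \<le> v" "0 \<le> w" "u + v + w = 1"
    and p: "p = u *\<^sub>R (- 1, - 1 / sqrt 3) + v *\<^sub>R (1, - 1 / sqrt 3) + w *\<^sub>R (0, 2 / sqrt 3)"
    unfolding ref_triangle_def convex_hull_3 by blast
  have "height (snd p) = (2 + u + v - 2 * w) / 3"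
    by (simp add: p height_def field_simps)
  then have "height (snd p) = u + v"
    using uvw by (simp add: field_simps)
  then show "p \<in> {(x, y). \<bar>x\<bar> \<le> height y \<and> height y \<le> 1}"
    using uvw by (auto simp: p)
next
  fix p assume "p \<in> {(x, y). \<bar>x\<bar> \<le> height y \<and> height y \<le> 1}"
  then obtain x y where p: "p = (x, y)" and xy: "\<bar>x\<bar> \<le> height y" "height y \<le> 1"
    by auto
  have "p = ((height y - x) / 2) *\<^sub>R (- 1, - 1 / sqrt 3) + ((height y + x) / 2) *\<^sub>R (1, - 1 / sqrt 3)
          + (1 - height y) *\<^sub>R (0, 2 / sqrt 3)"
    by (simp add: p height_def field_simps)
  then show "p \<in> ref_triangle"
    unfolding ref_triangle_def convex_hull_3 using xy
    by (intro CollectI exI[of _ "(height y - x) / 2"] exI[of _ "(height y + x) / 2"]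
        exI[of _ "1 - height y"]) (auto simp: field_simps)
qed

lemma compact_ref_triangle: "compact ref_triangle"
  unfolding ref_triangle_def by (intro finite_imp_compact_convex_hull) simp

text \<open>A short vertical segment through the point stays inside and \<open>height\<close> is
  strictly decreasing, which makes the bounds strict. Positivity keeps the point away from the
  singularity of the modes.\<close>

lemma interior_ref_triangle_height:
  assumes "(x, y) \<in> interior ref_triangle"
  shows "\<bar>x\<bar> \<le> height y" "0 < height y" "height y < 1"
proof -
  obtain e where e: "e > 0" "ball (x, y) e \<subseteq> ref_triangle"
    using assms by (auto simp: mem_interior)
  have "(x, y) \<in> ref_triangle" "(x, y + e / 2) \<in> ref_triangle" "(x, y - e / 2) \<in> ref_triangle"
    using e by (auto intro!: subsetD[OF e(2)] simp: dist_Pair_Pair dist_real_def)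
  moreover have "height (y + e / 2) < height y" "height y < height (y - e / 2)"
    using e(1) by (simp_all add: height_def field_simps)
  ultimately show "\<bar>x\<bar> \<le> height y" "0 < height y" "height y < 1"
    by (auto simp: ref_triangle_eq)
qed

lemma height_has_derivative [derivative_intros]:
  "(height has_field_derivative - (1 / sqrt 3)) (at y within A)"
  unfolding height_def [abs_def]
  by (auto intro!: derivative_eq_intros simp: field_simps)

lemma continuous_on_height [continuous_intros]: "continuous_on A height"
  unfolding height_def [abs_def] by (intro continuous_intros) auto

text \<open>The integral of \<open>x ^ a * t ^ b\<close> over
  \<open>\<bar>x\<bar> \<le> t \<le> 1\<close> with respect to dx dt; the factor
  \<open>sqrt 3\<close> that accompanies it below is the Jacobian of \<open>y\<close> with respect
  to \<open>t\<close>.\<close>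

definition moment :: "nat \<Rightarrow> nat \<Rightarrow> real" where
  "moment a b = (1 + (- 1) ^ a) / (real (a + 1) * real (a + b + 2))"

lemma moment_has_integral:
  "((\<lambda>(x, y). x ^ a * height y ^ b) has_integral sqrt 3 * moment a b) ref_triangle"
proof -
  define f where "f = (\<lambda>(x, y). x ^ a * height y ^ b)"
  define g where "g = (\<lambda>p. indicator ref_triangle p *\<^sub>R f p)"
  have cont: "continuous_on ref_triangle f"
    unfolding f_def case_prod_unfold
    by (intro continuous_intros continuous_on_compose2[OF continuous_on_height[of UNIV]]) auto
  \<comment> \<open>Fubini and the fundamental theorem are applied to the Lebesgue integral;
    \<open>has_integral_integral_lborel\<close> returns to the gauge integral at the end.\<close>
  have int: "integrable lborel g"
    unfolding g_def by (rule borel_integrable_compact[OF compact_ref_triangle cont])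
  have inner: "(\<integral>x. g (x, y) \<partial>lborel) =
      (((1 + (- 1) ^ a) / real (a + 1)) * height y ^ (a + b + 1)) * indicator {- 1 / sqrt 3..2 / sqrt 3} y" for y
  proof (cases "y \<in> {- 1 / sqrt 3..2 / sqrt 3}")
    case True
    then have h: "0 \<le> height y" "height y \<le> 1"
      by (auto simp: height_def field_simps)
    have "(\<integral>x. g (x, y) \<partial>lborel)
        = (\<integral>x. (x ^ a * height y ^ b) * indicator {- height y..height y} x \<partial>lborel)"
      using h by (intro Bochner_Integration.integral_cong)
        (auto simp: g_def f_def ref_triangle_eq indicator_def abs_le_iff)
    also have "\<dots> = height y ^ (a + 1) / real (a + 1) * height y ^ b
        - (- height y) ^ (a + 1) / real (a + 1) * height y ^ b"
    proof (rule integral_FTC_Icc_real[where F = "\<lambda>x. x ^ (a + 1) / real (a + 1) * height y ^ b"])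
      show "((\<lambda>x. x ^ (a + 1) / real (a + 1) * height y ^ b) has_real_derivative x ^ a * height y ^ b) (at x)" for x
        using DERIV_cmult[OF DERIV_pow[of "a + 1" x UNIV], of "height y ^ b / real (a + 1)"]
        by (simp add: field_simps del: of_nat_Suc of_nat_add)
    qed (use h in \<open>auto intro!: continuous_intros\<close>)
    also have "\<dots> = ((1 + (- 1) ^ a) / real (a + 1)) * height y ^ (a + b + 1)"
      by (simp add: power_minus[of "height y"] power_add add_divide_distrib distrib_right distrib_left mult_ac del: of_nat_Suc of_nat_add)
    finally show ?thesis
      using True by simp
  next
    case False
    then have "(x, y) \<notin> ref_triangle" for x
      by (auto simp: ref_triangle_eq height_def field_simps)
    then show ?thesis
      using False by (simp add: g_def)
  qed
  have "integral\<^sup>L lborel g = integral\<^sup>L (lborel \<Otimes>\<^sub>M lborel) (case_prod (\<lambda>x y. g (x, y)))"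
    by (simp add: lborel_prod)
  also have "\<dots> = (\<integral>y. (\<integral>x. g (x, y) \<partial>lborel) \<partial>lborel)"
    using int by (intro lborel_pair.integral_snd [symmetric]) (simp add: lborel_prod)
  also have "\<dots> = (\<integral>y. (((1 + (- 1) ^ a) / real (a + 1)) * height y ^ (a + b + 1))
      * indicator {- 1 / sqrt 3..2 / sqrt 3} y \<partial>lborel)"
    by (simp only: inner)
  \<comment> \<open>\<open>height\<close> falls from 1 to 0 between the end points, so the primitive
    carries a minus sign and only the lower end point contributes.\<close>
  also have "\<dots> =
      - (sqrt 3 * ((1 + (- 1) ^ a) / real (a + 1)) / real (a + b + 2)) * height (2 / sqrt 3) ^ (a + b + 2)
      - - (sqrt 3 * ((1 + (- 1) ^ a) / real (a + 1)) / real (a + b + 2)) * height (- 1 / sqrt 3) ^ (a + b + 2)"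
  proof (rule integral_FTC_Icc_real[where
        F = "\<lambda>y. - (sqrt 3 * ((1 + (- 1) ^ a) / real (a + 1)) / real (a + b + 2)) * height y ^ (a + b + 2)"])
    show "- 1 / sqrt 3 \<le> 2 / sqrt 3"
      by (simp add: field_simps)
    fix y
    show "isCont (\<lambda>y. ((1 + (- 1) ^ a) / real (a + 1)) * height y ^ (a + b + 1)) y"
      by (auto intro!: continuous_intros simp: height_def)
    have "((\<lambda>y. c * height y ^ (a + b + 2)) has_real_derivative
        c * (real (a + b + 2) * height y ^ (a + b + 1) * - (1 / sqrt 3))) (at y)" for c
      by (rule DERIV_cmult) (rule derivative_eq_intros, rule height_has_derivative, simp)
    then show "((\<lambda>y. - (sqrt 3 * ((1 + (- 1) ^ a) / real (a + 1)) / real (a + b + 2)) * height y ^ (a + b + 2))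
        has_real_derivative ((1 + (- 1) ^ a) / real (a + 1)) * height y ^ (a + b + 1)) (at y)"
      by (rule DERIV_cong) (simp add: divide_simps del: of_nat_Suc of_nat_add)
  qed
  also have "\<dots> = sqrt 3 * moment a b"
    by (simp add: height_def moment_def)
  finally have "(g has_integral sqrt 3 * moment a b) UNIV"
    using has_integral_integral_lborel[OF int] by simp
  then have "((\<lambda>p. if p \<in> ref_triangle then f p else 0) has_integral sqrt 3 * moment a b) UNIV"
    by (rule has_integral_eq[rotated]) (simp add: g_def)
  then show ?thesis
    by (simp add: has_integral_restrict_UNIV f_def)
qed

lemma has_integral_sum_list:
  fixes f :: "'c \<Rightarrow> 'a::euclidean_space \<Rightarrow> real"
  assumes "\<And>z. z \<in> set zs \<Longrightarrow> (f z has_integral I z) S"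
  shows "((\<lambda>t. \<Sum>z\<leftarrow>zs. f z t) has_integral (\<Sum>z\<leftarrow>zs. I z)) S"
  using assms by (induction zs) (auto intro!: has_integral_add)

lemma sum_list_mult_sum_list:
  fixes f :: "'a \<Rightarrow> real"
  shows "(\<Sum>z\<leftarrow>xs. f z) * (\<Sum>z\<leftarrow>ys. g z) = (\<Sum>z\<leftarrow>xs. \<Sum>w\<leftarrow>ys. f z * g w)"
  by (induction xs) (simp_all add: distrib_right sum_list_const_mult)

text \<open>Sparse polynomials as lists of monomials \<open>(c, a, b)\<close>: products, derivatives
  and integrals of concrete polynomials become finite sums that the simplifier evaluates.\<close>

definition peval :: "(real \<times> nat \<times> nat) list \<Rightarrow> real \<Rightarrow> real \<Rightarrow> real" where
  "peval p x t = (\<Sum>(c, a, b)\<leftarrow>p. c * x ^ a * t ^ b)"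

lemma peval_mult_has_integral:
  "((\<lambda>(x, y). peval p x (height y) * peval q x (height y)) has_integral
     sqrt 3 * (\<Sum>(c, a, b)\<leftarrow>p. \<Sum>(d, a', b')\<leftarrow>q. c * d * moment (a + a') (b + b'))) ref_triangle"
proof -
  have "((\<lambda>z. \<Sum>s\<leftarrow>p. \<Sum>r\<leftarrow>q. (\<lambda>(c, a, b) (d, a', b') (x, y).
        (c * d) * (x ^ (a + a') * height y ^ (b + b'))) s r z)
      has_integral (\<Sum>s\<leftarrow>p. \<Sum>r\<leftarrow>q. (\<lambda>(c, a, b) (d, a', b').
        (c * d) * (sqrt 3 * moment (a + a') (b + b'))) s r)) ref_triangle"
  proof (intro has_integral_sum_list)
    fix s r :: "real \<times> nat \<times> nat"
    obtain c a b d a' b' where "s = (c, a, b)" "r = (d, a', b')"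
      by (metis prod_cases3)
    then show "((\<lambda>(c, a, b) (d, a', b') (x, y). (c * d) * (x ^ (a + a') * height y ^ (b + b'))) s r has_integral
        (\<lambda>(c, a, b) (d, a', b'). (c * d) * (sqrt 3 * moment (a + a') (b + b'))) s r) ref_triangle"
      using has_integral_mult_right[OF moment_has_integral[of "a + a'" "b + b'"], of "c * d"]
      by (simp add: case_prod_unfold)
  qed
  moreover have "(\<lambda>z. \<Sum>s\<leftarrow>p. \<Sum>r\<leftarrow>q. (\<lambda>(c, a, b) (d, a', b') (x, y).
        (c * d) * (x ^ (a + a') * height y ^ (b + b'))) s r z)
      = (\<lambda>(x, y). peval p x (height y) * peval q x (height y))"
    by (auto simp: peval_def sum_list_mult_sum_list case_prod_unfold power_add mult_ac)
  moreover have "(\<Sum>s\<leftarrow>p. \<Sum>r\<leftarrow>q. (\<lambda>(c, a, b) (d, a', b').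
        (c * d) * (sqrt 3 * moment (a + a') (b + b'))) s r)
      = sqrt 3 * (\<Sum>(c, a, b)\<leftarrow>p. \<Sum>(d, a', b')\<leftarrow>q. c * d * moment (a + a') (b + b'))"
    by (simp add: sum_list_const_mult [symmetric] case_prod_unfold mult_ac)
  ultimately show ?thesis
    by simp
qed

section \<open>Norms of the Jacobi polynomials\<close>

lemma half_power_has_integral:
  "((\<lambda>t. ((1 - t) / 2) ^ m) has_integral 2 / real (m + 1)) {- 1..1::real}"
proof -
  have "((\<lambda>t. - (2 / real (m + 1)) * ((1 - t) / 2) ^ (m + 1)) has_real_derivative ((1 - t) / 2) ^ m)
      (at t within {- 1..1})" for t :: real
  proof -
    have "((\<lambda>t. ((1 - t) / 2) ^ (m + 1)) has_real_derivative
        real (m + 1) * ((1 - t) / 2) ^ m * (- 1 / 2)) (at t within {- 1..1})"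
      by (rule derivative_eq_intros | simp)+
    from DERIV_cmult[OF this, of "- (2 / real (m + 1))"] show ?thesis
      by (simp add: field_simps del: of_nat_Suc of_nat_add)
  qed
  from fundamental_theorem_of_calculus[OF _ this[THEN has_real_derivative_iff_has_vector_derivative[THEN iffD1]]]
  show ?thesis
    by simp
qed

lemma jacobi_square_integral:
  assumes "\<And>s. jacobi n \<alpha> 0 s = (\<Sum>(c, m)\<leftarrow>cs. c * ((1 - s) / 2) ^ m)"
  shows "integral {- 1..1} (\<lambda>t. (jacobi n \<alpha> 0 t)\<^sup>2 * (1 - t) ^ \<alpha> * (1 + t) ^ 0)
    = 2 ^ (\<alpha> + 1) * (\<Sum>(c, m)\<leftarrow>cs. \<Sum>(d, m')\<leftarrow>cs. c * d / real (m + m' + \<alpha> + 1))"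
proof -
  have "((\<lambda>t. \<Sum>z\<leftarrow>cs. \<Sum>w\<leftarrow>cs. (2 ^ \<alpha> * fst z * fst w) * ((1 - t) / 2) ^ (snd z + snd w + \<alpha>)) has_integral
     (\<Sum>z\<leftarrow>cs. \<Sum>w\<leftarrow>cs. (2 ^ \<alpha> * fst z * fst w) * (2 / real (snd z + snd w + \<alpha> + 1)))) {- 1..1}"
    by (intro has_integral_sum_list has_integral_mult_right half_power_has_integral)
  moreover have "(\<Sum>z\<leftarrow>cs. \<Sum>w\<leftarrow>cs. (2 ^ \<alpha> * fst z * fst w) * ((1 - t) / 2) ^ (snd z + snd w + \<alpha>))
      = (jacobi n \<alpha> 0 t)\<^sup>2 * (1 - t) ^ \<alpha> * (1 + t) ^ 0" for t
  proof -
    have "(1 - t) ^ \<alpha> = 2 ^ \<alpha> * ((1 - t) / 2) ^ \<alpha>"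
      by (simp add: power_divide)
    then show ?thesis
      unfolding assms power2_eq_square sum_list_mult_sum_list
      by (simp only: sum_list_const_mult [symmetric] sum_list_mult_const [symmetric] case_prod_unfold power_add mult_ac power_0 mult_1_left mult_1_right)
  qed
  moreover have "(\<Sum>z\<leftarrow>cs. \<Sum>w\<leftarrow>cs. (2 ^ \<alpha> * fst z * fst w) * (2 / real (snd z + snd w + \<alpha> + 1)))
      = 2 ^ (\<alpha> + 1) * (\<Sum>(c, m)\<leftarrow>cs. \<Sum>(d, m')\<leftarrow>cs. c * d / real (m + m' + \<alpha> + 1))"
    by (simp add: sum_list_const_mult [symmetric] case_prod_unfold mult_ac del: of_nat_Suc of_nat_add)
  ultimately show ?thesis
    by (metis (no_types, lifting) ext integral_unique)
qed

text \<open>Expansion at \<open>s = 1\<close> serves twice: the weight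
  \<open>(1 - s) ^ \<alpha>\<close> is a power of the same variable up to a constant, and at
  \<open>s = 1 - 2 * t\<close> the variable \<open>(1 - s) / 2\<close> is \<open>t\<close> itself.
  The cases are exactly the parameters met for degree at most 3.\<close>

lemma jacobi_expansions:
  "jacobi 0 0 0 s = (\<Sum>(c, m)\<leftarrow>[(1, 0)]. c * ((1 - s) / 2) ^ m)"
  "jacobi 1 0 0 s = (\<Sum>(c, m)\<leftarrow>[(1, 0), (- 2, 1)]. c * ((1 - s) / 2) ^ m)"
  "jacobi 2 0 0 s = (\<Sum>(c, m)\<leftarrow>[(1, 0), (- 6, 1), (6, 2)]. c * ((1 - s) / 2) ^ m)"
  "jacobi 3 0 0 s = (\<Sum>(c, m)\<leftarrow>[(1, 0), (- 12, 1), (30, 2), (- 20, 3)]. c * ((1 - s) / 2) ^ m)"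
  "jacobi 0 1 0 s = (\<Sum>(c, m)\<leftarrow>[(1, 0)]. c * ((1 - s) / 2) ^ m)"
  "jacobi 1 1 0 s = (\<Sum>(c, m)\<leftarrow>[(2, 0), (- 3, 1)]. c * ((1 - s) / 2) ^ m)"
  "jacobi 2 1 0 s = (\<Sum>(c, m)\<leftarrow>[(3, 0), (- 12, 1), (10, 2)]. c * ((1 - s) / 2) ^ m)"
  "jacobi 3 1 0 s = (\<Sum>(c, m)\<leftarrow>[(4, 0), (- 30, 1), (60, 2), (- 35, 3)]. c * ((1 - s) / 2) ^ m)"
  "jacobi 0 3 0 s = (\<Sum>(c, m)\<leftarrow>[(1, 0)]. c * ((1 - s) / 2) ^ m)"
  "jacobi 1 3 0 s = (\<Sum>(c, m)\<leftarrow>[(4, 0), (- 5, 1)]. c * ((1 - s) / 2) ^ m)"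
  "jacobi 2 3 0 s = (\<Sum>(c, m)\<leftarrow>[(10, 0), (- 30, 1), (21, 2)]. c * ((1 - s) / 2) ^ m)"
  "jacobi 0 5 0 s = (\<Sum>(c, m)\<leftarrow>[(1, 0)]. c * ((1 - s) / 2) ^ m)"
  "jacobi 1 5 0 s = (\<Sum>(c, m)\<leftarrow>[(6, 0), (- 7, 1)]. c * ((1 - s) / 2) ^ m)"
  "jacobi 0 7 0 s = (\<Sum>(c, m)\<leftarrow>[(1, 0)]. c * ((1 - s) / 2) ^ m)"
  by (simp_all add: jacobi_def numeral_eq_Suc atMost_Suc field_simps)

lemma normalised_legendre:
  assumes "v \<le> 3"
  shows "normalised_jacobi v 0 0 s = jacobi v 0 0 s / sqrt (2 / real (2 * v + 1))"
proof -
  have "v = 0 \<or> v = 1 \<or> v = 2 \<or> v = 3"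
    using assms by linarith
  then have "integral {- 1..1} (\<lambda>t. (jacobi v 0 0 t)\<^sup>2 * (1 - t) ^ 0 * (1 + t) ^ 0) = 2 / real (2 * v + 1)"
    by (elim disjE; hypsubst; subst jacobi_square_integral[OF jacobi_expansions(1)]
          jacobi_square_integral[OF jacobi_expansions(2)]
          jacobi_square_integral[OF jacobi_expansions(3)]
          jacobi_square_integral[OF jacobi_expansions(4)]; simp)
  then show ?thesis
    unfolding normalised_jacobi_def by (rule arg_cong)
qed

text \<open>For second parameter 0 the squared norm of the polynomial of degree n is 2^(\<alpha>+1)
  / (2n+\<alpha>+1); here n is \<open>w\<close> and \<alpha> is \<open>2 * v + 1\<close>. It is
  checked on the ten pairs that occur.\<close>

lemma normalised_jacobi_odd:
  assumes "v + w \<le> 3"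
  shows "normalised_jacobi w (2 * v + 1) 0 s
    = jacobi w (2 * v + 1) 0 s / sqrt (2 * 4 ^ v / real (v + w + 1))"
proof -
  have "v = 0 \<or> v = 1 \<or> v = 2 \<or> v = 3" "w = 0 \<or> w = 1 \<or> w = 2 \<or> w = 3"
    using assms by linarith+
  \<comment> \<open>The third component records the weight exponent as a numeral, in the form in
    which the expansions are stated.\<close>
  then have "(v, w, 2 * v + 1) \<in> {(0, 0, 1), (0, 1, 1), (0, 2, 1), (0, 3, 1), (1, 0, 3), (1, 1, 3), (1, 2, 3),
      (2, 0, 5), (2, 1, 5), (3, 0, 7)}"
    using assms by (elim disjE; simp)
  then have "integral {- 1..1} (\<lambda>t. (jacobi w \<alpha> 0 t)\<^sup>2 * (1 - t) ^ \<alpha> * (1 + t) ^ 0)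
      = 2 * 4 ^ v / real (v + w + 1)" if "\<alpha> = 2 * v + 1" for \<alpha>
    unfolding that [symmetric]
    by (elim insertE emptyE Pair_inject; hypsubst;
        subst jacobi_square_integral[OF jacobi_expansions(5)]
          jacobi_square_integral[OF jacobi_expansions(6)]
          jacobi_square_integral[OF jacobi_expansions(7)]
          jacobi_square_integral[OF jacobi_expansions(8)]
          jacobi_square_integral[OF jacobi_expansions(9)]
          jacobi_square_integral[OF jacobi_expansions(10)]
          jacobi_square_integral[OF jacobi_expansions(11)]
          jacobi_square_integral[OF jacobi_expansions(12)]
          jacobi_square_integral[OF jacobi_expansions(13)]
          jacobi_square_integral[OF jacobi_expansions(14)]; simp)
  from this[OF refl] show ?thesis
    unfolding normalised_jacobi_def by (rule arg_cong)
qed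

section \<open>The modes of degree at most 3 as polynomials\<close>

text \<open>From here on modes are numbered from 0, like rows and columns.\<close>

definition mode_index :: "nat \<Rightarrow> nat \<times> nat" where
  "mode_index i = [(0, 0), (0, 1), (0, 2), (0, 3), (1, 0), (1, 1), (1, 2), (2, 0), (2, 1), (3, 0)] ! i"

text \<open>With \<open>mode_index i = (v, w)\<close> the number under the root is
  \<open>(2 * v + 1) * (v + w + 1)\<close>.\<close>

definition mode_scale :: "nat \<Rightarrow> real" where
  "mode_scale i = sqrt ([1, 2, 3, 4, 6, 9, 12, 15, 20, 28] ! i)"

text \<open>Entry \<open>i\<close> expands \<open>t ^ v * jacobi v 0 0 (x / t) * jacobi w (2 * v +
  1) 0 (1 - 2 * t)\<close>.\<close>

definition mode_poly :: "nat \<Rightarrow> (real \<times> nat \<times> nat) list" where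
  "mode_poly i =
    [[(1, 0, 0)],
     [(2, 0, 0), (- 3, 0, 1)],
     [(3, 0, 0), (- 12, 0, 1), (10, 0, 2)],
     [(4, 0, 0), (- 30, 0, 1), (60, 0, 2), (- 35, 0, 3)],
     [(1, 1, 0)],
     [(4, 1, 0), (- 5, 1, 1)],
     [(10, 1, 0), (- 30, 1, 1), (21, 1, 2)],
     [(- 1 / 2, 0, 2), (3 / 2, 2, 0)],
     [(- 3, 0, 2), (9, 2, 0), (7 / 2, 0, 3), (- 21 / 2, 2, 1)],
     [(- 3 / 2, 1, 2), (5 / 2, 3, 0)]] ! i"

lemma less_10_cases:
  fixes i :: nat
  assumes "i < 10"
  shows "i = 0 \<or> i = 1 \<or> i = 2 \<or> i = 3 \<or> i = 4 \<or> i = 5 \<or> i = 6 \<or> i = 7 \<or> i = 8 \<or> i = 9"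
  using assms by presburger

lemma all_less_10:
  "(\<forall>i<10. P i) \<longleftrightarrow> P 0 \<and> P 1 \<and> P 2 \<and> P 3 \<and> P 4 \<and> P 5 \<and> P 6 \<and> P 7 \<and> P 8 \<and> P (9::nat)"
  using less_10_cases by auto

lemma sum_less_10:
  "sum f {..<10::nat} = f 0 + f 1 + f 2 + f 3 + f 4 + f 5 + f 6 + f 7 + f 8 + f 9"
  by (simp add: numeral_eq_Suc add.assoc)

lemma mode_scale_pos: "i < 10 \<Longrightarrow> mode_scale i > 0"
  by (drule less_10_cases) (auto simp: mode_scale_def)

text \<open>The modes with given \<open>v\<close> form a block of consecutive indices starting at
  \<open>v * (9 - v) / 2\<close>, that is at 0, 4, 7, 9. The bound \<open>v + w \<le> 3\<close>
  keeps the blocks disjoint, so the description is unique.\<close>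

lemma dubiner_index_3:
  assumes "i < 10"
  shows "dubiner_index 3 (i + 1) = mode_index i"
proof -
  obtain v w where vw: "mode_index i = (v, w)"
    by fastforce
  have index: "v + w \<le> 3 \<and> (int v)\<^sup>2 - 9 * int v = 2 * (int w - int i)"
    using less_10_cases[OF assms] vw by (elim disjE; simp add: mode_index_def; clarsimp)
  have unique: "v' = v \<and> w' = w"
    if "v' + w' \<le> 3" "(int v')\<^sup>2 - 9 * int v' = 2 * (int w' - int i)" for v' w'
  proof -
    have "v' = 0 \<or> v' = 1 \<or> v' = 2 \<or> v' = 3" "v = 0 \<or> v = 1 \<or> v = 2 \<or> v = 3"
      using that index by linarith+
    then show ?thesis
      using that index by (elim disjE; hypsubst; simp; linarith?)
  qed
  show ?thesis
    unfolding dubiner_index_def vw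
  proof (rule the_equality)
    fix p
    assume "case p of (v', w') \<Rightarrow> v' + w' \<le> 3 \<and>
      0 = (int v')\<^sup>2 - (2 * int 3 + 3) * int v' - 2 * (int w' - int (i + 1) + 1)"
    then show "p = (v, w)"
      using unique[of "fst p" "snd p"] by (cases p) simp
  qed (use index in simp)
qed

text \<open>Since \<open>1 - b = 2 * t\<close>, the power \<open>(1 - b) ^ v\<close> contributes
  both \<open>t ^ v\<close> and \<open>2 ^ v\<close>. The constant \<open>2 * 2 ^ v\<close> divided
  by the two Jacobi norms leaves the square root.\<close>

lemma dubiner_eq_jacobi:
  assumes "dubiner_index k i = (v, w)" "v + w \<le> 3" "height y \<noteq> 0"
  shows "dubiner k i (x, y) = sqrt (real ((2 * v + 1) * (v + w + 1))) / root 4 3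
    * (height y ^ v * jacobi v 0 0 (x / height y) * jacobi w (2 * v + 1) 0 (1 - 2 * height y))"
proof -
  have args: "3 * x / (2 - sqrt 3 * y) = x / height y" "(2 * sqrt 3 * y - 1) / 3 = 1 - 2 * height y"
    using assms(3) by (simp_all add: height_def field_simps)
  have "sqrt (2 / real (2 * v + 1)) * sqrt (2 * 4 ^ v / real (v + w + 1)) * sqrt (real ((2 * v + 1) * (v + w + 1)))
      = sqrt ((2 / real (2 * v + 1)) * (2 * 4 ^ v / real (v + w + 1)) * real ((2 * v + 1) * (v + w + 1)))"
    by (simp only: real_sqrt_mult)
  also have "(2 / real (2 * v + 1)) * (2 * 4 ^ v / real (v + w + 1)) * real ((2 * v + 1) * (v + w + 1))
      = (2 * 2 ^ v)\<^sup>2"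
    by (simp add: power_mult_distrib power2_eq_square[of "2 ^ v"] power_mult_distrib [symmetric]
        del: of_nat_Suc of_nat_add mult_Suc mult_Suc_right)
  also have "sqrt ((2 * 2 ^ v)\<^sup>2) = 2 * 2 ^ v"
    by (subst real_sqrt_abs) simp
  finally have "sqrt (2 / real (2 * v + 1)) * sqrt (2 * 4 ^ v / real (v + w + 1))
      * sqrt (real ((2 * v + 1) * (v + w + 1))) = 2 * 2 ^ v" .
  moreover have "sqrt (2 / real (2 * v + 1)) > 0" "sqrt (2 * 4 ^ v / real (v + w + 1)) > 0"
    by simp_all
  ultimately have norm: "2 * 2 ^ v / (sqrt (2 / real (2 * v + 1)) * sqrt (2 * 4 ^ v / real (v + w + 1)))
      = sqrt (real ((2 * v + 1) * (v + w + 1)))"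
    by (metis mult_eq_0_iff nonzero_mult_div_cancel_left order_less_irrefl)
  have "dubiner k i (x, y) = 2 * 2 ^ v / (sqrt (2 / real (2 * v + 1)) * sqrt (2 * 4 ^ v / real (v + w + 1)))
      / root 4 3 * (height y ^ v * jacobi v 0 0 (x / height y) * jacobi w (2 * v + 1) 0 (1 - 2 * height y))"
    unfolding dubiner_def assms(1) Let_def prod.case args normalised_jacobi_odd[OF assms(2)]
    using assms(2) by (simp add: normalised_legendre power_mult_distrib mult_ac)
  then show ?thesis
    by (simp only: norm)
qed

text \<open>The power of \<open>h\<close> homogenises the Legendre polynomial and so cancels the
  denominators of the collapsed coordinate; the singularity of the modes is removable.\<close>

lemma legendre_homogeneous:
  assumes "h \<noteq> 0"
  shows "h ^ 0 * jacobi 0 0 0 (x / h) = 1"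
    "h ^ 1 * jacobi 1 0 0 (x / h) = x"
    "h ^ 2 * jacobi 2 0 0 (x / h) = 3 / 2 * x ^ 2 - 1 / 2 * h ^ 2"
    "h ^ 3 * jacobi 3 0 0 (x / h) = 5 / 2 * x ^ 3 - 3 / 2 * x * h ^ 2"
  unfolding jacobi_expansions using assms
  by (simp_all add: field_simps power2_eq_square power3_eq_cube)

lemma dubiner_eq_mode_poly:
  assumes "i < 10" "height y \<noteq> 0"
  shows "dubiner 3 (i + 1) (x, y) = mode_scale i / root 4 3 * peval (mode_poly i) x (height y)"
proof -
  obtain v w where vw: "mode_index i = (v, w)"
    by fastforce
  have le: "v + w \<le> 3" and scale: "mode_scale i = sqrt (real ((2 * v + 1) * (v + w + 1)))"
    using less_10_cases[OF assms(1)] vw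
    by (elim disjE; hypsubst; simp add: mode_index_def mode_scale_def; clarsimp)+
  have poly: "peval (mode_poly i) x h = h ^ v * jacobi v 0 0 (x / h) * jacobi w (2 * v + 1) 0 (1 - 2 * h)"
    if "h \<noteq> 0" for h
    using less_10_cases[OF assms(1)] vw that
    by (elim disjE; hypsubst; simp add: mode_index_def; clarsimp;
        simp add: mode_poly_def peval_def legendre_homogeneous legendre_homogeneous[simplified]
          jacobi_expansions(5-) jacobi_expansions(5-)[simplified];
        simp add: algebra_simps diff_divide_distrib power2_eq_square power3_eq_cube)
  from assms(1) vw have "dubiner_index 3 (i + 1) = (v, w)"
    by (simp only: dubiner_index_3)
  from dubiner_eq_jacobi[OF this le assms(2)] show ?thesis
    by (simp only: scale poly[OF assms(2)])
qed

section \<open>Orthonormality and modal matrices\<close>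

lemma mode_poly_orthogonal:
  assumes "i < 10" "j < 10"
  shows "(\<Sum>(c, a, b)\<leftarrow>mode_poly i. \<Sum>(d, a', b')\<leftarrow>mode_poly j. c * d * moment (a + a') (b + b'))
    = (if i = j then 1 / (mode_scale i)\<^sup>2 else 0)"
proof -
  have "\<forall>i<10. \<forall>j<10. (\<Sum>(c, a, b)\<leftarrow>mode_poly i. \<Sum>(d, a', b')\<leftarrow>mode_poly j.
      c * d * moment (a + a') (b + b')) = (if i = j then 1 / (mode_scale i)\<^sup>2 else 0)"
    unfolding all_less_10
    by (intro conjI; simp add: mode_poly_def mode_scale_def moment_def)
  then show ?thesis
    using assms by blast
qed

lemma dubiner_orthonormal:
  assumes "i < 10" "j < 10"
  shows "((\<lambda>p. dubiner 3 (i + 1) p * dubiner 3 (j + 1) p) has_integral (if i = j then 1 else 0)) ref_triangle"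
proof -
  define c where "c = mode_scale i / root 4 3 * (mode_scale j / root 4 3)"
  have "root 4 3 = sqrt (sqrt 3)"
    using real_root_mult_exp[of 2 2 3] by (simp add: sqrt_def)
  then have "root 4 3 * root 4 3 = sqrt 3"
    by simp
  \<comment> \<open>The two factors \<open>1 / root 4 3\<close> cancel the Jacobian
    \<open>sqrt 3\<close> of the coordinate \<open>t\<close>.\<close>
  then have c: "c * sqrt 3 = mode_scale i * mode_scale j"
    unfolding c_def by (metis real_sqrt_eq_zero_cancel_iff times_divide_times_eq nonzero_eq_divide_eq zero_neq_numeral)
  have "((\<lambda>p. c * (case p of (x, y) \<Rightarrow> peval (mode_poly i) x (height y) * peval (mode_poly j) x (height y)))
      has_integral c * (sqrt 3 * (if i = j then 1 / (mode_scale i)\<^sup>2 else 0))) ref_triangle"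
    using has_integral_mult_right[OF peval_mult_has_integral[of "mode_poly i" "mode_poly j"]]
    unfolding mode_poly_orthogonal[OF assms] .
  moreover have "c * (sqrt 3 * (if i = j then 1 / (mode_scale i)\<^sup>2 else 0)) = (if i = j then 1 else 0)"
    using c mode_scale_pos[OF assms(1)] by (auto simp: mult.assoc [symmetric] power2_eq_square)
  ultimately have "((\<lambda>p. c * (case p of (x, y) \<Rightarrow> peval (mode_poly i) x (height y) * peval (mode_poly j) x (height y)))
      has_integral (if i = j then 1 else 0)) ref_triangle"
    by simp
  then show ?thesis
  \<comment> \<open>At the top vertex the formula divides by zero and may differ from the
    polynomial; a single point does not change the integral.\<close>
  proof (rule has_integral_spike_finite[of "{(0, 2 / sqrt 3)}", rotated 2])
    fix p assume "p \<in> ref_triangle - {(0, 2 / sqrt 3)}"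
    moreover obtain x y where p: "p = (x, y)"
      by fastforce
    ultimately have "height y \<noteq> 0"
      by (auto simp: ref_triangle_eq height_def field_simps)
    then show "dubiner 3 (i + 1) p * dubiner 3 (j + 1) p
        = c * (case p of (x, y) \<Rightarrow> peval (mode_poly i) x (height y) * peval (mode_poly j) x (height y))"
      using dubiner_eq_mode_poly[OF assms(1)] dubiner_eq_mode_poly[OF assms(2)]
      by (simp add: p c_def)
  qed simp
qed

lemma num_modes_3: "num_modes 3 = 10"
  by (simp add: num_modes_def)

lemma mass_matrix_3: "mass_matrix 3 = 1\<^sub>m 10"
  unfolding mass_matrix_def num_modes_3
  by (rule eq_matI) (use integral_unique[OF dubiner_orthonormal] in auto)

text \<open>Integrating against mode \<open>j\<close> isolates \<open>c j\<close>. The values on the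
  interior suffice because the frontier of a convex set is negligible. This is the uniqueness behind
  \<open>modal_matrix\<close>.\<close>

lemma dubiner_independent:
  assumes "\<And>p. p \<in> interior ref_triangle \<Longrightarrow> (\<Sum>i<10. c i * dubiner 3 (i + 1) p) = 0" "j < 10"
  shows "c j = 0"
proof -
  have "((\<lambda>p. \<Sum>i<10. c i * (dubiner 3 (i + 1) p * dubiner 3 (j + 1) p)) has_integral
      (\<Sum>i<10. c i * (if i = j then 1 else 0))) ref_triangle"
    using assms(2) by (intro has_integral_sum has_integral_mult_right dubiner_orthonormal) auto
  then have "((\<lambda>p. (\<Sum>i<10. c i * dubiner 3 (i + 1) p) * dubiner 3 (j + 1) p) has_integral c j) ref_triangle"
    using assms(2) by (simp add: sum_distrib_right mult.assoc if_distrib[of "(*) _"] cong: if_cong)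
  then have "((\<lambda>p. (\<Sum>i<10. c i * dubiner 3 (i + 1) p) * dubiner 3 (j + 1) p) has_integral c j) (interior ref_triangle)"
    by (subst has_integral_interior) (auto simp: ref_triangle_def intro!: negligible_convex_frontier)
  moreover have "((\<lambda>p. (\<Sum>i<10. c i * dubiner 3 (i + 1) p) * dubiner 3 (j + 1) p) has_integral 0) (interior ref_triangle)"
    by (rule has_integral_is_0) (use assms(1) in simp)
  ultimately show ?thesis
    by (rule has_integral_unique)
qed

text \<open>An operator with coefficients \<open>A\<close> on the rational polynomials \<open>mode_poly\<close> has this matrix in the
  normalised basis; for a bilinear form it is \<open>form_matrix\<close> below.\<close>

definition scaled_matrix :: "(nat \<Rightarrow> nat \<Rightarrow> real) \<Rightarrow> real mat" where
  "scaled_matrix A = Matrix.mat 10 10 (\<lambda>(i, j). A i j * mode_scale j / mode_scale i)"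

text \<open>Turns the definite description into a polynomial identity: rescaling the coefficients
  \<open>A\<close> gives existence, independence of the modes gives uniqueness.\<close>

lemma modal_matrix_3_eqI:
  assumes "\<And>j x y. j < 10 \<Longrightarrow> (x, y) \<in> interior ref_triangle \<Longrightarrow>
    T (dubiner 3 (j + 1)) (x, y) = mode_scale j / root 4 3 * (\<Sum>i<10. A i j * peval (mode_poly i) x (height y))"
  shows "modal_matrix 3 T = scaled_matrix A"
  unfolding modal_matrix_def num_modes_3
proof (rule the_equality)
  have "T (dubiner 3 (j + 1)) p = (\<Sum>i<10. scaled_matrix A $$ (i, j) * dubiner 3 (i + 1) p)"
    if "j < 10" "p \<in> interior ref_triangle" for j p
  proof -
    obtain x y where p: "p = (x, y)"
      by fastforce
    have "T (dubiner 3 (j + 1)) (x, y) = (\<Sum>i<10. mode_scale j / root 4 3 * (A i j * peval (mode_poly i) x (height y)))"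
      using assms that by (simp add: p sum_distrib_left)
    also have "\<dots> = (\<Sum>i<10. scaled_matrix A $$ (i, j) * dubiner 3 (i + 1) (x, y))"
    proof (rule sum.cong)
      fix i :: nat
      assume "i \<in> {..<10}"
      then show "mode_scale j / root 4 3 * (A i j * peval (mode_poly i) x (height y))
          = scaled_matrix A $$ (i, j) * dubiner 3 (i + 1) (x, y)"
        using that interior_ref_triangle_height[of x y] dubiner_eq_mode_poly[of i y x] mode_scale_pos[of i]
        by (simp add: p scaled_matrix_def)
    qed simp
    finally show ?thesis
      by (simp only: p)
  qed
  then show *: "scaled_matrix A \<in> carrier_mat 10 10 \<and> (\<forall>j<10. \<forall>p\<in>interior ref_triangle.
      T (dubiner 3 (j + 1)) p = (\<Sum>i<10. scaled_matrix A $$ (i, j) * dubiner 3 (i + 1) p))"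
    by (simp add: scaled_matrix_def)
  fix B
  assume B: "B \<in> carrier_mat 10 10 \<and> (\<forall>j<10. \<forall>p\<in>interior ref_triangle.
      T (dubiner 3 (j + 1)) p = (\<Sum>i<10. B $$ (i, j) * dubiner 3 (i + 1) p))"
  have "B $$ (i, j) - scaled_matrix A $$ (i, j) = 0" if "i < 10" "j < 10" for i j
    using * B that
    by (intro dubiner_independent[of "\<lambda>i. B $$ (i, j) - scaled_matrix A $$ (i, j)" i])
      (simp_all add: left_diff_distrib sum_subtractf)
  then show "B = scaled_matrix A"
    using B by (intro eq_matI) (auto simp: scaled_matrix_def)
qed

section \<open>Differentiation and the symmetries on the polynomial modes\<close>

definition pderiv_fst :: "(real \<times> nat \<times> nat) list \<Rightarrow> (real \<times> nat \<times> nat) list" where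
  "pderiv_fst p = map (\<lambda>(c, a, b). (c * real a, a - 1, b)) p"

definition pderiv_snd :: "(real \<times> nat \<times> nat) list \<Rightarrow> (real \<times> nat \<times> nat) list" where
  "pderiv_snd p = map (\<lambda>(c, a, b). (c * real b, a, b - 1)) p"

lemma peval_fst_has_derivative:
  "((\<lambda>x. peval p x t) has_real_derivative peval (pderiv_fst p) x t) (at x)"
proof (induction p)
  case (Cons s p)
  obtain c a b where s: "s = (c, a, b)"
    by (metis prod_cases3)
  have "((\<lambda>x. c * x ^ a * t ^ b) has_real_derivative c * real a * x ^ (a - 1) * t ^ b) (at x)"
    by (auto intro!: derivative_eq_intros)
  from DERIV_add[OF this Cons.IH] show ?case
    by (simp add: s peval_def pderiv_fst_def)
qed (simp add: peval_def pderiv_fst_def)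

lemma peval_snd_has_derivative:
  "((\<lambda>t. peval p x t) has_real_derivative peval (pderiv_snd p) x t) (at t)"
proof (induction p)
  case (Cons s p)
  obtain c a b where s: "s = (c, a, b)"
    by (metis prod_cases3)
  have "((\<lambda>t. c * x ^ a * t ^ b) has_real_derivative c * real b * x ^ a * t ^ (b - 1)) (at t)"
    by (auto intro!: derivative_eq_intros)
  from DERIV_add[OF this Cons.IH] show ?case
    by (simp add: s peval_def pderiv_snd_def)
qed (simp add: peval_def pderiv_snd_def)

definition dx_coeff :: "nat \<Rightarrow> nat \<Rightarrow> real" where
  "dx_coeff i j =
  [[0, 0, 0, 0, 1, 2 / 3, 1 / 2, 0, 0, 1 / 2],
   [0, 0, 0, 0, 0, 5 / 3, 8 / 5, 0, 0, - 2 / 5],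
   [0, 0, 0, 0, 0, 0, 21 / 10, 0, 0, 1 / 10],
   [0, 0, 0, 0, 0, 0, 0, 0, 0, 0],
   [0, 0, 0, 0, 0, 0, 0, 3, 6 / 5, 0],
   [0, 0, 0, 0, 0, 0, 0, 0, 21 / 5, 0],
   [0, 0, 0, 0, 0, 0, 0, 0, 0, 0],
   [0, 0, 0, 0, 0, 0, 0, 0, 0, 5],
   [0, 0, 0, 0, 0, 0, 0, 0, 0, 0],
   [0, 0, 0, 0, 0, 0, 0, 0, 0, 0]] ! i ! j"

text \<open>Differentiation by \<open>t\<close>; since \<open>y = (2 - 3 * t) / sqrt 3\<close>, it is \<open>- sqrt 3\<close> times that by \<open>y\<close>.\<close>

definition dt_coeff :: "nat \<Rightarrow> nat \<Rightarrow> real" where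
  "dt_coeff i j =
  [[0, - 3, 4 / 3, - 5 / 2, 0, 0, 0, - 2 / 3, - 1 / 2, 0],
   [0, 0, - 20 / 3, 2, 0, 0, 0, 1 / 3, - 4 / 5, 0],
   [0, 0, 0, - 21 / 2, 0, 0, 0, 0, 7 / 10, 0],
   [0, 0, 0, 0, 0, 0, 0, 0, 0, 0],
   [0, 0, 0, 0, 0, - 5, 18 / 5, 0, 0, - 12 / 5],
   [0, 0, 0, 0, 0, 0, - 42 / 5, 0, 0, 3 / 5],
   [0, 0, 0, 0, 0, 0, 0, 0, 0, 0],
   [0, 0, 0, 0, 0, 0, 0, 0, - 7, 0],
   [0, 0, 0, 0, 0, 0, 0, 0, 0, 0],
   [0, 0, 0, 0, 0, 0, 0, 0, 0, 0]] ! i ! j"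

definition rotation_coeff :: "nat \<Rightarrow> nat \<Rightarrow> real" where
  "rotation_coeff i j =
  [[1, 0, 0, 0, 0, 0, 0, 0, 0, 0],
   [0, - 1 / 2, 0, 0, - 1 / 2, 0, 0, 0, 0, 0],
   [0, 0, 1 / 3, 0, 0, 1 / 3, 0, 1 / 3, 0, 0],
   [0, 0, 0, - 1 / 4, 0, 0, - 1 / 4, 0, - 1 / 4, - 1 / 4],
   [0, 3 / 2, 0, 0, - 1 / 2, 0, 0, 0, 0, 0],
   [0, 0, - 1, 0, 0, - 1 / 2, 0, 1 / 2, 0, 0],
   [0, 0, 0, 3 / 4, 0, 0, 11 / 20, 0, 3 / 20, - 9 / 20],
   [0, 0, 5 / 3, 0, 0, - 5 / 6, 0, 1 / 6, 0, 0],
   [0, 0, 0, - 5 / 4, 0, 0, - 1 / 4, 0, 3 / 4, - 1 / 4],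
   [0, 0, 0, 7 / 4, 0, 0, - 21 / 20, 0, 7 / 20, - 1 / 20]] ! i ! j"

text \<open>The modes 4, 5, 6, 9 are those with odd \<open>v\<close>, hence odd in
  \<open>x\<close>.\<close>

definition reflection_coeff :: "nat \<Rightarrow> nat \<Rightarrow> real" where
  "reflection_coeff i j = (if i = j then if i \<in> {4, 5, 6, 9} then - 1 else 1 else 0)"

lemma dx_coeff:
  assumes "j < 10"
  shows "peval (pderiv_fst (mode_poly j)) x t = (\<Sum>i<10. dx_coeff i j * peval (mode_poly i) x t)"
  using less_10_cases[OF assms] unfolding sum_less_10
  by (elim disjE; hypsubst; simp add: dx_coeff_def mode_poly_def pderiv_fst_def peval_def;
      simp add: field_simps power2_eq_square power3_eq_cube)

lemma dt_coeff:
  assumes "j < 10"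
  shows "peval (pderiv_snd (mode_poly j)) x t = (\<Sum>i<10. dt_coeff i j * peval (mode_poly i) x t)"
  using less_10_cases[OF assms] unfolding sum_less_10
  by (elim disjE; hypsubst; simp add: dt_coeff_def mode_poly_def pderiv_snd_def peval_def;
      simp add: field_simps power2_eq_square power3_eq_cube)

text \<open>In the coordinates \<open>x\<close> and \<open>t\<close> the rotation becomes this
  affine map with rational coefficients, since every \<open>sqrt 3\<close> of the rotation meets one
  from \<open>y = (2 - 3 * t) / sqrt 3\<close>.\<close>

lemma rotation_coeff:
  assumes "j < 10"
  shows "peval (mode_poly j) (- 1 - x / 2 + 3 * t / 2) (1 - x / 2 - t / 2)
    = (\<Sum>i<10. rotation_coeff i j * peval (mode_poly i) x t)"
  using less_10_cases[OF assms] unfolding sum_less_10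
  by (elim disjE; hypsubst; simp add: rotation_coeff_def mode_poly_def peval_def;
      simp add: field_simps power2_eq_square power3_eq_cube)

lemma reflection_coeff:
  assumes "j < 10"
  shows "peval (mode_poly j) (- x) t = (\<Sum>i<10. reflection_coeff i j * peval (mode_poly i) x t)"
  using less_10_cases[OF assms] unfolding sum_less_10
  by (elim disjE; hypsubst; simp add: reflection_coeff_def mode_poly_def peval_def)

lemma D_x_3: "D_x 3 = scaled_matrix dx_coeff"
  unfolding D_x_def
proof (rule modal_matrix_3_eqI)
  fix j :: nat and x y
  assume j: "j < 10" and "(x, y) \<in> interior ref_triangle"
  then have h: "height y \<noteq> 0"
    using interior_ref_triangle_height[of x y] by simp
  have "partial_x (dubiner 3 (j + 1)) (x, y) = deriv (\<lambda>t. mode_scale j / root 4 3 * peval (mode_poly j) t (height y)) x"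
    by (simp only: partial_x_def prod.case dubiner_eq_mode_poly[OF j h])
  also have "\<dots> = mode_scale j / root 4 3 * peval (pderiv_fst (mode_poly j)) x (height y)"
    by (intro DERIV_imp_deriv DERIV_cmult peval_fst_has_derivative)
  finally show "partial_x (dubiner 3 (j + 1)) (x, y)
      = mode_scale j / root 4 3 * (\<Sum>i<10. dx_coeff i j * peval (mode_poly i) x (height y))"
    by (simp only: dx_coeff[OF j])
qed

lemma D_y_3: "D_y 3 = scaled_matrix (\<lambda>i j. - (1 / sqrt 3) * dt_coeff i j)"
  unfolding D_y_def
proof (rule modal_matrix_3_eqI)
  fix j :: nat and x y
  assume j: "j < 10" and "(x, y) \<in> interior ref_triangle"
  then have "height y > 0"
    using interior_ref_triangle_height[of x y] by simp
  \<comment> \<open>Varying \<open>x\<close> leaves \<open>height\<close> fixed, but varying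
    \<open>y\<close> can reach the singular line; the polynomial formula is available only in a
    neighbourhood, which is enough for the derivative.\<close>
  moreover have "(height \<longlongrightarrow> height y) (nhds y)"
    using continuous_on_height[of UNIV] by (simp add: continuous_on_eq_continuous_at isCont_def tendsto_at_iff_tendsto_nhds)
  ultimately have "\<forall>\<^sub>F s in nhds y. height s > 0"
    by (rule order_tendstoD(1)[rotated])
  then have "\<forall>\<^sub>F s in nhds y. dubiner 3 (j + 1) (x, s) = mode_scale j / root 4 3 * peval (mode_poly j) x (height s)"
    by eventually_elim (use dubiner_eq_mode_poly[OF j] in simp)
  then have "partial_y (dubiner 3 (j + 1)) (x, y) = deriv (\<lambda>s. mode_scale j / root 4 3 * peval (mode_poly j) x (height s)) y"
    unfolding partial_y_def prod.case by (rule deriv_cong_ev) simp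
  also have "\<dots> = mode_scale j / root 4 3 * (peval (pderiv_snd (mode_poly j)) x (height y) * - (1 / sqrt 3))"
    by (intro DERIV_imp_deriv DERIV_cmult DERIV_chain2[OF peval_snd_has_derivative] height_has_derivative)
  finally show "partial_y (dubiner 3 (j + 1)) (x, y)
      = mode_scale j / root 4 3 * (\<Sum>i<10. - (1 / sqrt 3) * dt_coeff i j * peval (mode_poly i) x (height y))"
    by (simp add: dt_coeff[OF j] sum_distrib_left sum_negf sum_divide_distrib mult_ac)
qed

lemma rotation_matrix_3: "rotation_matrix 3 = scaled_matrix rotation_coeff"
  unfolding rotation_matrix_def
proof (rule modal_matrix_3_eqI)
  fix j :: nat and x y
  assume j: "j < 10" and "(x, y) \<in> interior ref_triangle"
  \<comment> \<open>This is the height of the rotated point: the polynomial formula has to be valid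
    there as well.\<close>
  then have "1 - x / 2 - height y / 2 \<noteq> 0"
    using interior_ref_triangle_height[of x y] by linarith
  moreover have "rotation (x, y) = (- 1 - x / 2 + 3 * height y / 2, sqrt 3 / 2 * x - y / 2)"
    by (simp add: rotation_def cos_120' sin_120' height_def field_simps)
  moreover have "height (sqrt 3 / 2 * x - y / 2) = 1 - x / 2 - height y / 2"
    by (simp add: height_def field_simps)
  ultimately show "(dubiner 3 (j + 1) \<circ> rotation) (x, y)
      = mode_scale j / root 4 3 * (\<Sum>i<10. rotation_coeff i j * peval (mode_poly i) x (height y))"
    using dubiner_eq_mode_poly[OF j] by (simp add: rotation_coeff[OF j, symmetric])
qed

lemma reflection_matrix_3: "reflection_matrix 3 = scaled_matrix reflection_coeff"
  unfolding reflection_matrix_def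
proof (rule modal_matrix_3_eqI)
  fix j :: nat and x y
  assume j: "j < 10" and "(x, y) \<in> interior ref_triangle"
  then have "height y \<noteq> 0"
    using interior_ref_triangle_height[of x y] by simp
  then show "(dubiner 3 (j + 1) \<circ> reflection) (x, y)
      = mode_scale j / root 4 3 * (\<Sum>i<10. reflection_coeff i j * peval (mode_poly i) x (height y))"
    using dubiner_eq_mode_poly[OF j] by (simp add: reflection_def reflection_coeff[OF j, symmetric])
qed

section \<open>The extended-range conditions\<close>

definition form_matrix :: "(nat \<Rightarrow> nat \<Rightarrow> real) \<Rightarrow> real mat" where
  "form_matrix B = Matrix.mat 10 10 (\<lambda>(i, j). B i j * mode_scale i * mode_scale j)"

lemma form_matrix_surj:
  assumes "Q \<in> carrier_mat 10 10"
  obtains B where "Q = form_matrix B"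
proof
  show "Q = form_matrix (\<lambda>i j. Q $$ (i, j) / (mode_scale i * mode_scale j))"
    using assms mode_scale_pos by (intro eq_matI) (auto simp: form_matrix_def less_imp_neq[symmetric])
qed

lemma form_matrix_cong:
  assumes "\<And>i j. i < 10 \<Longrightarrow> j < 10 \<Longrightarrow> A i j = B i j"
  shows "form_matrix A = form_matrix B"
  using assms by (intro eq_matI) (auto simp: form_matrix_def)

lemma scaled_matrix_cong:
  assumes "\<And>i j. i < 10 \<Longrightarrow> j < 10 \<Longrightarrow> A i j = B i j"
  shows "scaled_matrix A = scaled_matrix B"
  using assms by (intro eq_matI) (auto simp: scaled_matrix_def)

lemma form_matrix_eq_iff:
  "form_matrix A = form_matrix B \<longleftrightarrow> (\<forall>i<10. \<forall>j<10. A i j = B i j)"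
proof
  assume *: "form_matrix A = form_matrix B"
  show "\<forall>i<10. \<forall>j<10. A i j = B i j"
  proof (intro allI impI)
    fix i j :: nat
    assume "i < 10" "j < 10"
    then show "A i j = B i j"
      using arg_cong[OF *, of "\<lambda>M. M $$ (i, j)"] mode_scale_pos[of i] mode_scale_pos[of j]
      by (simp add: form_matrix_def)
  qed
qed (auto intro: form_matrix_cong)

lemma scaled_matrix_mult:
  "scaled_matrix A * scaled_matrix B = scaled_matrix (\<lambda>i j. \<Sum>k<10. A i k * B k j)"
proof (rule eq_matI)
  fix i j
  assume "i < dim_row (scaled_matrix (\<lambda>i j. \<Sum>k<10. A i k * B k j))"
    "j < dim_col (scaled_matrix (\<lambda>i j. \<Sum>k<10. A i k * B k j))"
  then have ij: "i < 10" "j < 10"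
    by (auto simp: scaled_matrix_def)
  have "(\<Sum>k<10. A i k * mode_scale k / mode_scale i * (B k j * mode_scale j / mode_scale k))
      = (\<Sum>k<10. A i k * B k j * mode_scale j / mode_scale i)"
    by (intro sum.cong) (auto dest: mode_scale_pos)
  then show "(scaled_matrix A * scaled_matrix B) $$ (i, j)
      = scaled_matrix (\<lambda>i j. \<Sum>k<10. A i k * B k j) $$ (i, j)"
    using ij by (simp add: scaled_matrix_def scalar_prod_def atLeast0LessThan sum_distrib_right sum_divide_distrib)
qed (simp_all add: scaled_matrix_def)

lemma form_matrix_symmetric_iff:
  "form_matrix B = transpose_mat (form_matrix B) \<longleftrightarrow> (\<forall>i<10. \<forall>j<10. B i j = B j i)"
proof -
  have "transpose_mat (form_matrix B) = form_matrix (\<lambda>i j. B j i)"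
    by (rule eq_matI) (auto simp: form_matrix_def)
  then show ?thesis
    by (simp only: form_matrix_eq_iff)
qed

text \<open>The scale of the summation index cancels and those of \<open>i\<close> and
  \<open>j\<close> factor out, so skewness keeps its shape and involves no roots.\<close>

lemma form_matrix_skew_iff:
  "form_matrix B * scaled_matrix A + transpose_mat (scaled_matrix A) * transpose_mat (form_matrix B) = 0\<^sub>m 10 10
    \<longleftrightarrow> (\<forall>i<10. \<forall>j<10. (\<Sum>k<10. B i k * A k j + A k i * B j k) = 0)"
proof -
  have "form_matrix B * scaled_matrix A + transpose_mat (scaled_matrix A) * transpose_mat (form_matrix B)
      = form_matrix (\<lambda>i j. \<Sum>k<10. B i k * A k j + A k i * B j k)"
  proof (rule eq_matI)
    fix i j
    assume "i < dim_row (form_matrix (\<lambda>i j. \<Sum>k<10. B i k * A k j + A k i * B j k))"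
      "j < dim_col (form_matrix (\<lambda>i j. \<Sum>k<10. B i k * A k j + A k i * B j k))"
    then have ij: "i < 10" "j < 10"
      by (auto simp: form_matrix_def)
    have "(\<Sum>k<10. B i k * mode_scale i * mode_scale k * (A k j * mode_scale j / mode_scale k))
        + (\<Sum>k<10. A k i * mode_scale i / mode_scale k * (B j k * mode_scale j * mode_scale k))
        = (\<Sum>k<10. (B i k * A k j + A k i * B j k) * mode_scale i * mode_scale j)"
      unfolding sum.distrib [symmetric]
      by (intro sum.cong refl) (auto dest!: mode_scale_pos simp: field_simps)
    then show "(form_matrix B * scaled_matrix A + transpose_mat (scaled_matrix A) * transpose_mat (form_matrix B)) $$ (i, j)
        = form_matrix (\<lambda>i j. \<Sum>k<10. B i k * A k j + A k i * B j k) $$ (i, j)"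
      using ij by (simp add: form_matrix_def scaled_matrix_def scalar_prod_def atLeast0LessThan sum_distrib_right)
  qed (simp_all add: form_matrix_def scaled_matrix_def)
  moreover have "0\<^sub>m 10 10 = form_matrix (\<lambda>i j. 0)"
    by (rule eq_matI) (auto simp: form_matrix_def)
  ultimately show ?thesis
    by (simp only: form_matrix_eq_iff)
qed

text \<open>Commuting treats the form as an operator, with coefficients
  \<open>(mode_scale i)\<^sup>2 * B i j\<close>. Only squares of scales survive, and these are
  natural numbers.\<close>

lemma form_matrix_commute_iff:
  "form_matrix B * scaled_matrix A = scaled_matrix A * form_matrix B
    \<longleftrightarrow> (\<forall>i<10. \<forall>j<10. (\<Sum>k<10. (mode_scale i)\<^sup>2 * B i k * A k j) = (\<Sum>k<10. A i k * (mode_scale k)\<^sup>2 * B k j))"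
proof -
  have "form_matrix B * scaled_matrix A
      = form_matrix (\<lambda>i j. (\<Sum>k<10. (mode_scale i)\<^sup>2 * B i k * A k j) / (mode_scale i)\<^sup>2)"
  proof (rule eq_matI)
    fix i j
    assume "i < dim_row (form_matrix (\<lambda>i j. (\<Sum>k<10. (mode_scale i)\<^sup>2 * B i k * A k j) / (mode_scale i)\<^sup>2))"
      "j < dim_col (form_matrix (\<lambda>i j. (\<Sum>k<10. (mode_scale i)\<^sup>2 * B i k * A k j) / (mode_scale i)\<^sup>2))"
    then have ij: "i < 10" "j < 10"
      by (auto simp: form_matrix_def)
    have "(\<Sum>k<10. B i k * mode_scale i * mode_scale k * (A k j * mode_scale j / mode_scale k))
        = (\<Sum>k<10. (mode_scale i)\<^sup>2 * B i k * A k j / (mode_scale i)\<^sup>2 * mode_scale i * mode_scale j)"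
      using mode_scale_pos[OF ij(1)] by (intro sum.cong refl) (auto dest!: mode_scale_pos)
    then show "(form_matrix B * scaled_matrix A) $$ (i, j)
        = form_matrix (\<lambda>i j. (\<Sum>k<10. (mode_scale i)\<^sup>2 * B i k * A k j) / (mode_scale i)\<^sup>2) $$ (i, j)"
      using ij by (simp add: form_matrix_def scaled_matrix_def scalar_prod_def atLeast0LessThan sum_distrib_right sum_divide_distrib)
  qed (simp_all add: form_matrix_def scaled_matrix_def)
  moreover have "scaled_matrix A * form_matrix B
      = form_matrix (\<lambda>i j. (\<Sum>k<10. A i k * (mode_scale k)\<^sup>2 * B k j) / (mode_scale i)\<^sup>2)"
  proof (rule eq_matI)
    fix i j
    assume "i < dim_row (form_matrix (\<lambda>i j. (\<Sum>k<10. A i k * (mode_scale k)\<^sup>2 * B k j) / (mode_scale i)\<^sup>2))"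
      "j < dim_col (form_matrix (\<lambda>i j. (\<Sum>k<10. A i k * (mode_scale k)\<^sup>2 * B k j) / (mode_scale i)\<^sup>2))"
    then have ij: "i < 10" "j < 10"
      by (auto simp: form_matrix_def)
    have "(\<Sum>k<10. A i k * mode_scale k / mode_scale i * (B k j * mode_scale k * mode_scale j))
        = (\<Sum>k<10. A i k * (mode_scale k)\<^sup>2 * B k j / (mode_scale i)\<^sup>2 * mode_scale i * mode_scale j)"
      using mode_scale_pos[OF ij(1)] by (intro sum.cong refl) (simp add: power2_eq_square)
    then show "(scaled_matrix A * form_matrix B) $$ (i, j)
        = form_matrix (\<lambda>i j. (\<Sum>k<10. A i k * (mode_scale k)\<^sup>2 * B k j) / (mode_scale i)\<^sup>2) $$ (i, j)"
      using ij by (simp add: form_matrix_def scaled_matrix_def scalar_prod_def atLeast0LessThan sum_distrib_right sum_divide_distrib)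
  qed (simp_all add: form_matrix_def scaled_matrix_def)
  ultimately have "form_matrix B * scaled_matrix A = scaled_matrix A * form_matrix B
    \<longleftrightarrow> (\<forall>i<10. \<forall>j<10. (\<Sum>k<10. (mode_scale i)\<^sup>2 * B i k * A k j) / (mode_scale i)\<^sup>2
        = (\<Sum>k<10. A i k * (mode_scale k)\<^sup>2 * B k j) / (mode_scale i)\<^sup>2)"
    by (simp only: form_matrix_eq_iff)
  then show ?thesis
    using mode_scale_pos by (auto simp: less_imp_neq[symmetric])
qed

lemma extended_range_conditions_form_matrix_iff:
  "extended_range_conditions 3 (form_matrix B) \<longleftrightarrow>
    (\<forall>i<10. \<forall>j<10. B i j = B j i) \<and>
    (\<forall>i<10. \<forall>j<10. (\<Sum>k<10. B i k * dx_coeff k j + dx_coeff k i * B j k) = 0) \<and>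
    (\<forall>i<10. \<forall>j<10. (\<Sum>k<10. B i k * dt_coeff k j + dt_coeff k i * B j k) = 0) \<and>
    (\<forall>i<10. \<forall>j<10. (\<Sum>k<10. (mode_scale i)\<^sup>2 * B i k * rotation_coeff k j)
        = (\<Sum>k<10. rotation_coeff i k * (mode_scale k)\<^sup>2 * B k j)) \<and>
    (\<forall>i<10. \<forall>j<10. (\<Sum>k<10. (mode_scale i)\<^sup>2 * B i k * reflection_coeff k j)
        = (\<Sum>k<10. reflection_coeff i k * (mode_scale k)\<^sup>2 * B k j))"
proof -
  \<comment> \<open>The factor between differentiation by \<open>y\<close> and by \<open>t\<close>
    divides out of a homogeneous linear condition.\<close>
  have "(\<Sum>k<10. B i k * (- (1 / sqrt 3) * dt_coeff k j) + - (1 / sqrt 3) * dt_coeff k i * B j k)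
      = - (1 / sqrt 3) * (\<Sum>k<10. B i k * dt_coeff k j + dt_coeff k i * B j k)" for i j
    unfolding sum_distrib_left by (intro sum.cong) (simp_all add: algebra_simps)
  then have "(\<Sum>k<10. B i k * (- (1 / sqrt 3) * dt_coeff k j) + - (1 / sqrt 3) * dt_coeff k i * B j k) = 0
      \<longleftrightarrow> (\<Sum>k<10. B i k * dt_coeff k j + dt_coeff k i * B j k) = 0" for i j
    by simp
  then show ?thesis
    unfolding extended_range_conditions_def D_x_3 D_y_3 rotation_matrix_3 reflection_matrix_3 num_modes_3
      form_matrix_skew_iff form_matrix_commute_iff form_matrix_symmetric_iff
    by (simp only:)
qed

text \<open>The parameters are the coefficients at \<open>(8, 8)\<close>, \<open>(9, 9)\<close> and
  \<open>(6, 9)\<close>, namely \<open>q1 / 20\<close>, \<open>q0 / 28\<close> and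
  \<open>sqrt 21 * q2 / 84\<close>. In terms of these all other entries are rational.\<close>

definition family_coeff :: "real \<Rightarrow> real \<Rightarrow> real \<Rightarrow> nat \<Rightarrow> nat \<Rightarrow> real" where
  "family_coeff p r m i j =
    (if (i, j) = (3, 3) then 28 / 5 * r + 12 / 5 * m + p
     else if (i, j) = (3, 8) \<or> (i, j) = (8, 3) then 7 / 5 * r + 3 / 5 * m - p
     else if (i, j) = (8, 8) then p
     else if (i, j) = (6, 6) then 7 / 3 * r - 4 / 3 * m
     else if (i, j) = (6, 9) \<or> (i, j) = (9, 6) then m
     else if (i, j) = (9, 9) then r
     else 0)"

lemma family_coeff_eq_0:
  assumes "i \<notin> {3, 6, 8, 9} \<or> j \<notin> {3, 6, 8, 9}"
  shows "family_coeff p r m i j = 0"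
  using assms by (auto simp: family_coeff_def)

lemma family_coeff_sym: "family_coeff p r m i j = family_coeff p r m j i"
proof (cases "i \<in> {3, 6, 8, 9} \<and> j \<in> {3, 6, 8, 9}")
  case True
  then show ?thesis
    by (elim conjE insertE emptyE; simp add: family_coeff_def)
next
  case False
  then have "family_coeff p r m i j = 0" "family_coeff p r m j i = 0"
    by (intro family_coeff_eq_0; blast)+
  then show ?thesis
    by simp
qed

text \<open>The modes 3, 6, 8, 9 are those of degree 3: derivatives have no component along them, and
  rotations do not mix them with the others.\<close>

lemma dx_coeff_top_eq_0:
  assumes "k \<in> {3, 6, 8, 9}" "j < 10"
  shows "dx_coeff k j = 0"
  using assms(1) less_10_cases[OF assms(2)] by (elim insertE emptyE disjE; simp add: dx_coeff_def)

lemma dt_coeff_top_eq_0: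
  assumes "k \<in> {3, 6, 8, 9}" "j < 10"
  shows "dt_coeff k j = 0"
  using assms(1) less_10_cases[OF assms(2)] by (elim insertE emptyE disjE; simp add: dt_coeff_def)

lemma rotation_coeff_top_eq_0:
  assumes "k \<in> {3, 6, 8, 9}" "j < 10" "j \<notin> {3, 6, 8, 9}"
  shows "rotation_coeff k j = 0" "rotation_coeff j k = 0"
proof -
  have "j \<in> {0, 1, 2, 4, 5, 7}"
    using less_10_cases[OF assms(2)] assms(3) by auto
  then show "rotation_coeff k j = 0" "rotation_coeff j k = 0"
    using assms(1) by (elim insertE emptyE; simp add: rotation_coeff_def)+
qed

text \<open>Each summand vanishes by itself: for \<open>k\<close> of degree 3 the derivative has no
  component along \<open>k\<close>, for every other \<open>k\<close> the form is zero.\<close>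

lemma family_coeff_skew:
  assumes "\<And>k j. k \<in> {3, 6, 8, 9} \<Longrightarrow> j < 10 \<Longrightarrow> D k j = 0" "i < 10" "j < 10"
  shows "(\<Sum>k<10. family_coeff p r m i k * D k j + D k i * family_coeff p r m j k) = 0"
proof (rule sum.neutral, rule ballI)
  fix k :: nat
  show "family_coeff p r m i k * D k j + D k i * family_coeff p r m j k = 0"
    using assms by (cases "k \<in> {3, 6, 8, 9}") (simp_all add: family_coeff_eq_0 del: insert_iff)
qed

lemma rotation_coeff_top:
  "rotation_coeff 3 3 = - 1 / 4" "rotation_coeff 3 6 = - 1 / 4" "rotation_coeff 3 8 = - 1 / 4" "rotation_coeff 3 9 = - 1 / 4"
  "rotation_coeff 6 3 = 3 / 4" "rotation_coeff 6 6 = 11 / 20" "rotation_coeff 6 8 = 3 / 20" "rotation_coeff 6 9 = - 9 / 20"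
  "rotation_coeff 8 3 = - 5 / 4" "rotation_coeff 8 6 = - 1 / 4" "rotation_coeff 8 8 = 3 / 4" "rotation_coeff 8 9 = - 1 / 4"
  "rotation_coeff 9 3 = 7 / 4" "rotation_coeff 9 6 = - 21 / 20" "rotation_coeff 9 8 = 7 / 20" "rotation_coeff 9 9 = - 1 / 20"
  by (simp_all add: rotation_coeff_def)

lemma mode_scale_square_top:
  "(mode_scale 3)\<^sup>2 = 4" "(mode_scale 6)\<^sup>2 = 12" "(mode_scale 8)\<^sup>2 = 20" "(mode_scale 9)\<^sup>2 = 28"
  by (simp_all add: mode_scale_def)

lemma family_coeff_top:
  "family_coeff p r m 3 3 = 28 / 5 * r + 12 / 5 * m + p" "family_coeff p r m 3 6 = 0" "family_coeff p r m 3 8 = 7 / 5 * r + 3 / 5 * m - p" "family_coeff p r m 3 9 = 0"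
  "family_coeff p r m 6 3 = 0" "family_coeff p r m 6 6 = 7 / 3 * r - 4 / 3 * m" "family_coeff p r m 6 8 = 0" "family_coeff p r m 6 9 = m"
  "family_coeff p r m 8 3 = 7 / 5 * r + 3 / 5 * m - p" "family_coeff p r m 8 6 = 0" "family_coeff p r m 8 8 = p" "family_coeff p r m 8 9 = 0"
  "family_coeff p r m 9 3 = 0" "family_coeff p r m 9 6 = m" "family_coeff p r m 9 8 = 0" "family_coeff p r m 9 9 = r"
  by (simp_all add: family_coeff_def)

lemma sum_top_modes:
  fixes f :: "nat \<Rightarrow> real"
  assumes "\<And>k. k \<notin> {3, 6, 8, 9} \<Longrightarrow> f k = 0"
  shows "(\<Sum>k<10. f k) = f 3 + f 6 + f 8 + f 9"
proof -
  have "(\<Sum>k<10. f k) = sum f {3, 6, 8, 9}"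
    using assms by (intro sum.mono_neutral_right) auto
  then show ?thesis
    by simp
qed

lemma family_coeff_rotation:
  assumes "i < 10" "j < 10"
  shows "(\<Sum>k<10. (mode_scale i)\<^sup>2 * family_coeff p r m i k * rotation_coeff k j)
      = (\<Sum>k<10. rotation_coeff i k * (mode_scale k)\<^sup>2 * family_coeff p r m k j)"
proof -
  have left: "(\<Sum>k<10. (mode_scale i)\<^sup>2 * family_coeff p r m i k * rotation_coeff k j)
      = (mode_scale i)\<^sup>2 * family_coeff p r m i 3 * rotation_coeff 3 j
      + (mode_scale i)\<^sup>2 * family_coeff p r m i 6 * rotation_coeff 6 j
      + (mode_scale i)\<^sup>2 * family_coeff p r m i 8 * rotation_coeff 8 j
      + (mode_scale i)\<^sup>2 * family_coeff p r m i 9 * rotation_coeff 9 j"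
    by (rule sum_top_modes) (simp add: family_coeff_eq_0 del: insert_iff)
  have right: "(\<Sum>k<10. rotation_coeff i k * (mode_scale k)\<^sup>2 * family_coeff p r m k j)
      = rotation_coeff i 3 * (mode_scale 3)\<^sup>2 * family_coeff p r m 3 j
      + rotation_coeff i 6 * (mode_scale 6)\<^sup>2 * family_coeff p r m 6 j
      + rotation_coeff i 8 * (mode_scale 8)\<^sup>2 * family_coeff p r m 8 j
      + rotation_coeff i 9 * (mode_scale 9)\<^sup>2 * family_coeff p r m 9 j"
    by (rule sum_top_modes) (simp add: family_coeff_eq_0 del: insert_iff)
  consider "i \<in> {3, 6, 8, 9}" "j \<in> {3, 6, 8, 9}" | "i \<notin> {3, 6, 8, 9}" | "j \<notin> {3, 6, 8, 9}"
    by blast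
  then show ?thesis
  proof cases
    case 1
    then show ?thesis
      unfolding left right
      by (elim insertE emptyE; hypsubst; simp only: family_coeff_top rotation_coeff_top mode_scale_square_top; simp add: algebra_simps)
  next
    case 2
    then have "family_coeff p r m i k = 0" "k \<in> {3, 6, 8, 9} \<Longrightarrow> rotation_coeff i k = 0" for k
      using assms by (blast intro: family_coeff_eq_0 rotation_coeff_top_eq_0)+
    then show ?thesis
      unfolding left right by simp
  next
    case 3
    then have "family_coeff p r m k j = 0" "k \<in> {3, 6, 8, 9} \<Longrightarrow> rotation_coeff k j = 0" for k
      using assms by (blast intro: family_coeff_eq_0 rotation_coeff_top_eq_0)+
    then show ?thesis
      unfolding left right by simp
  qed
qed

lemma reflection_coeff_sum:
  assumes "i < 10" "j < 10"
  shows "(\<Sum>k<10. a k * reflection_coeff k j) = a j * reflection_coeff j j"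
    "(\<Sum>k<10. reflection_coeff i k * b k * c k) = reflection_coeff i i * b i * c i"
  using assms
  by (simp_all add: reflection_coeff_def if_distrib[of "(*) _"] if_distrib[of "\<lambda>a. a * _"] cong: if_cong)

lemma family_coeff_reflection:
  assumes "i < 10" "j < 10"
  shows "(\<Sum>k<10. (mode_scale i)\<^sup>2 * family_coeff p r m i k * reflection_coeff k j)
      = (\<Sum>k<10. reflection_coeff i k * (mode_scale k)\<^sup>2 * family_coeff p r m k j)"
  unfolding reflection_coeff_sum[OF assms]
proof (cases "i \<in> {3, 6, 8, 9} \<and> j \<in> {3, 6, 8, 9}")
  case True
  then show "(mode_scale i)\<^sup>2 * family_coeff p r m i j * reflection_coeff j j
      = reflection_coeff i i * (mode_scale i)\<^sup>2 * family_coeff p r m i j"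
    by (elim conjE insertE emptyE; simp add: family_coeff_def reflection_coeff_def)
qed (simp add: family_coeff_eq_0)

section \<open>Elimination: the conditions force the family\<close>

lemma extended_range_conditions_imp_family_coeff:
  assumes "extended_range_conditions 3 (form_matrix B)"
  shows "\<forall>i<10. \<forall>j<10. B i j = family_coeff (B 8 8) (B 9 9) (B 6 9) i j"
proof -
  have sym: "B j i = B i j" if "i < j" "j < 10" for i j
    using assms that unfolding extended_range_conditions_form_matrix_iff by auto
  have x: "(\<Sum>k<10. B i k * dx_coeff k j + dx_coeff k i * B j k) = 0"
    and t: "(\<Sum>k<10. B i k * dt_coeff k j + dt_coeff k i * B j k) = 0"
    and rot: "(\<Sum>k<10. (mode_scale i)\<^sup>2 * B i k * rotation_coeff k j)
        = (\<Sum>k<10. rotation_coeff i k * (mode_scale k)\<^sup>2 * B k j)"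
    and refl: "(\<Sum>k<10. (mode_scale i)\<^sup>2 * B i k * reflection_coeff k j)
        = (\<Sum>k<10. reflection_coeff i k * (mode_scale k)\<^sup>2 * B k j)"
    if "i < 10" "j < 10" for i j
    using assms that unfolding extended_range_conditions_form_matrix_iff by blast+
  \<comment> \<open>The reflection is diagonal with entries 1 and -1, so commuting with it kills the
    entries between modes even and odd in \<open>x\<close>.\<close>
  have parity: "B i j = 0" if "i < 10" "j < 10" "(i \<in> {4, 5, 6, 9}) \<noteq> (j \<in> {4, 5, 6, 9})" for i j
  proof -
    have "(mode_scale i)\<^sup>2 * B i j * reflection_coeff j j = reflection_coeff i i * (mode_scale i)\<^sup>2 * B i j"
      using refl[OF that(1,2)] unfolding reflection_coeff_sum[OF that(1,2)] .
    then show ?thesis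
      using that mode_scale_pos[OF that(1)] by (auto simp: reflection_coeff_def)
  qed
  note x = x[unfolded sum_less_10 dx_coeff_def] and t = t[unfolded sum_less_10 dt_coeff_def]
  \<comment> \<open>All remaining entries are brought above the diagonal; \<open>Suc 0\<close> is
    the form to which the simplifier reduces the index 1.\<close>
  have syms:
    "B (Suc 0) 0 = B 0 (Suc 0)" "B 2 0 = B 0 2" "B 3 0 = B 0 3" "B 7 0 = B 0 7" "B 8 0 = B 0 8"
    "B 2 (Suc 0) = B (Suc 0) 2" "B 3 (Suc 0) = B (Suc 0) 3" "B 7 (Suc 0) = B (Suc 0) 7" "B 8 (Suc 0) = B (Suc 0) 8" "B 3 2 = B 2 3"
    "B 7 2 = B 2 7" "B 8 2 = B 2 8" "B 7 3 = B 3 7" "B 8 3 = B 3 8" "B 8 7 = B 7 8"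
    "B 5 4 = B 4 5" "B 6 4 = B 4 6" "B 9 4 = B 4 9" "B 6 5 = B 5 6" "B 9 5 = B 5 9"
    "B 9 6 = B 6 9"
    by (rule sym; simp)+
  \<comment> \<open>The equation for \<open>i\<close> and \<open>j\<close> reads B(i, D j) + B(D i,
    j) = 0. Each pair is chosen so that, after parity and the zeros already found, a single unknown
    entry is left; hence the order of the steps.\<close>
  have B00: "B 0 0 = 0"
    using t[of 0 1] by (simp add: syms parity)
  have B01: "B 0 (Suc 0) = 0"
    using t[of 1 1] by (simp add: syms parity)
  have B02: "B 0 2 = 0"
    using x[of 2 4] by (simp add: syms parity)
  have B03: "B 0 3 = 0"
    using x[of 3 4] by (simp add: syms parity)
  have B44: "B 4 4 = 0"
    using t[of 4 5] by (simp add: syms parity)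
  have B45: "B 4 5 = 0"
    using t[of 5 5] by (simp add: syms parity)
  note zeros = B00 B01 B02 B03 B44 B45
  have B07: "B 0 7 = 0"
    using t[of 0 8] by (simp add: syms parity zeros)
  have B11: "B (Suc 0) (Suc 0) = 0"
    using t[of 1 2] by (simp add: syms parity zeros)
  have B12: "B (Suc 0) 2 = 0"
    using t[of 2 2] by (simp add: syms parity zeros)
  \<comment> \<open>Differentiation by \<open>t\<close> alone would merely tie this entry to
    \<open>B 2 2\<close>. The second direction kills it: mode 3 does not depend on \<open>x\<close>,
    and the \<open>x\<close> derivative of mode 5 is a combination of modes 0 and 1.\<close>
  have B13: "B (Suc 0) 3 = 0"
    using x[of 3 5] by (simp add: syms parity zeros)
  have B08: "B 0 8 = 0"
    using x[of 4 8] by (simp add: syms parity zeros)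
  note zeros = zeros B07 B11 B12 B13 B08
  have B17: "B (Suc 0) 7 = 0"
    using t[of 1 8] by (simp add: syms parity zeros)
  have B22: "B 2 2 = 0"
    using t[of 2 3] by (simp add: syms parity zeros)
  have B23: "B 2 3 = 0"
    using t[of 3 3] by (simp add: syms parity zeros)
  note zeros = zeros B17 B22 B23
  have B27: "B 2 7 = 0"
    using x[of 2 9] by (simp add: syms parity zeros)
  have B37: "B 3 7 = 0"
    using x[of 3 9] by (simp add: syms parity zeros)
  note zeros = zeros B27 B37
  have B18: "B (Suc 0) 8 = 0"
    using t[of 2 8] by (simp add: syms parity zeros)
  have B46: "B 4 6 = 0"
    using x[of 6 7] by (simp add: syms parity zeros)
  note zeros = zeros B18 B46
  have B28: "B 2 8 = 0"
    using t[of 3 8] by (simp add: syms parity zeros)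
  have B55: "B 5 5 = 0"
    using t[of 5 6] by (simp add: syms parity zeros)
  have B56: "B 5 6 = 0"
    using t[of 6 6] by (simp add: syms parity zeros)
  have B77: "B 7 7 = 0"
    using t[of 7 8] by (simp add: syms parity zeros)
  note zeros = zeros B28 B55 B56 B77
  have B49: "B 4 9 = 0"
    using t[of 5 9] by (simp add: syms parity zeros)
  have B78: "B 7 8 = 0"
    using t[of 8 8] by (simp add: syms parity zeros)
  note zeros = zeros B49 B78
  have B59: "B 5 9 = 0"
    using t[of 6 9] by (simp add: syms parity zeros)
  note zeros = zeros B59
  \<comment> \<open>Only the even block of modes 3, 8 and the odd block of modes 6, 9 are left, with
    six unknowns; three entries of the rotation condition reduce them to three.\<close>
  have "B 6 6 = 7 / 3 * B 9 9 - 4 / 3 * B 6 9"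
    using rot[of 6 9] by (simp add: sum_less_10 rotation_coeff_def mode_scale_square_top syms parity zeros)
  moreover have "B 3 3 = 4 * B 3 8 + 5 * B 8 8"
    using rot[of 3 8] by (simp add: sum_less_10 rotation_coeff_def mode_scale_square_top syms parity zeros)
  moreover have "B 3 3 = 3 * B 6 9 - B 3 8 + 7 * B 9 9"
    using rot[of 3 9] by (simp add: sum_less_10 rotation_coeff_def mode_scale_square_top syms parity zeros)
  ultimately have "B 6 6 = 7 / 3 * B 9 9 - 4 / 3 * B 6 9" "B 3 3 = 28 / 5 * B 9 9 + 12 / 5 * B 6 9 + B 8 8"
    "B 3 8 = 7 / 5 * B 9 9 + 3 / 5 * B 6 9 - B 8 8"
    by linarith+
  note top = this
  show ?thesis
    unfolding all_less_10
    by (intro conjI; (simp only: One_nat_def syms zeros family_coeff_top top)?; simp add: family_coeff_eq_0 parity)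
qed

lemma extended_range_conditions_iff_family_coeff:
  "extended_range_conditions 3 (form_matrix B) \<longleftrightarrow> (\<exists>p r m. form_matrix B = form_matrix (family_coeff p r m))"
proof
  assume "extended_range_conditions 3 (form_matrix B)"
  from extended_range_conditions_imp_family_coeff[OF this]
  show "\<exists>p r m. form_matrix B = form_matrix (family_coeff p r m)"
    unfolding form_matrix_eq_iff by blast
next
  have "extended_range_conditions 3 (form_matrix (family_coeff p r m))" for p r m
    unfolding extended_range_conditions_form_matrix_iff
    by (intro conjI allI impI family_coeff_sym family_coeff_skew dx_coeff_top_eq_0 dt_coeff_top_eq_0
        family_coeff_rotation family_coeff_reflection)
  then show "\<exists>p r m. form_matrix B = form_matrix (family_coeff p r m) \<Longrightarrow> extended_range_conditions 3 (form_matrix B)"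
    by metis
qed

section \<open>The three-parameter family\<close>

lemma sqrt_family_constants:
  "sqrt (48 / 175) = 4 * sqrt 21 / 35"
  "sqrt (3 / 35) = sqrt 21 / (7 * sqrt 5)"
  "sqrt (16 / 21) = 4 * sqrt 21 / 21"
  by (rule real_sqrt_unique; simp add: power_divide power_mult_distrib)+

lemma Q_family_index:
  assumes "i < 10" "j < 10"
  shows "Q_family q0 q1 q2 $$ (i, j) =
    (if (i, j) = (3, 3) then (q1 + 4 * q0) / 5 + 4 * (sqrt 21 * q2) / 35
     else if (i, j) = (3, 8) \<or> (i, j) = (8, 3) then (q0 - q1 + sqrt 21 * q2 / 7) / sqrt 5
     else if (i, j) = (8, 8) then q1
     else if (i, j) = (6, 6) then q0 - 4 * (sqrt 21 * q2) / 21
     else if (i, j) = (6, 9) \<or> (i, j) = (9, 6) then q2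
     else if (i, j) = (9, 9) then q0
     else 0)"
  using assms by (simp add: Q_family_def Let_def sqrt_family_constants add_divide_distrib)

lemma Q_family_index_eq_0:
  assumes "i < 10" "j < 10" "i \<notin> {3, 6, 8, 9} \<or> j \<notin> {3, 6, 8, 9}"
  shows "Q_family q0 q1 q2 $$ (i, j) = 0"
  unfolding Q_family_index[OF assms(1,2)] using assms(3) by auto

text \<open>The mixed products are the source of \<open>sqrt 5\<close> and \<open>sqrt 21\<close> in
  the family.\<close>

lemma mode_scale_mult_top:
  "mode_scale 3 * mode_scale 3 = 4" "mode_scale 6 * mode_scale 6 = 12"
  "mode_scale 8 * mode_scale 8 = 20" "mode_scale 9 * mode_scale 9 = 28"
  "mode_scale 3 * mode_scale 8 = 20 / sqrt 5" "mode_scale 8 * mode_scale 3 = 20 / sqrt 5"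
  "mode_scale 6 * mode_scale 9 = 84 / sqrt 21" "mode_scale 9 * mode_scale 6 = 84 / sqrt 21"
proof -
  have "sqrt 20 = 10 / sqrt 5" "sqrt 12 * sqrt 28 = 84 / sqrt 21"
    unfolding real_sqrt_mult [symmetric] by (rule real_sqrt_unique; simp add: power_divide)+
  then show "mode_scale 3 * mode_scale 8 = 20 / sqrt 5" "mode_scale 8 * mode_scale 3 = 20 / sqrt 5"
    "mode_scale 6 * mode_scale 9 = 84 / sqrt 21" "mode_scale 9 * mode_scale 6 = 84 / sqrt 21"
    by (simp_all add: mode_scale_def mult.commute)
qed (simp_all add: mode_scale_def)

text \<open>The divisors come from the products of scales: 20 at \<open>(8, 8)\<close>, 28 at
  \<open>(9, 9)\<close> and \<open>84 / sqrt 21\<close> at \<open>(6, 9)\<close>.\<close>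

lemma Q_family_eq_form_matrix:
  "Q_family q0 q1 q2 = form_matrix (family_coeff (q1 / 20) (q0 / 28) (sqrt 21 * q2 / 84))"
proof (rule eq_matI)
  fix i j
  assume "i < dim_row (form_matrix (family_coeff (q1 / 20) (q0 / 28) (sqrt 21 * q2 / 84)))"
    "j < dim_col (form_matrix (family_coeff (q1 / 20) (q0 / 28) (sqrt 21 * q2 / 84)))"
  then have ij: "i < 10" "j < 10"
    by (auto simp: form_matrix_def)
  then have form: "form_matrix (family_coeff (q1 / 20) (q0 / 28) (sqrt 21 * q2 / 84)) $$ (i, j)
      = family_coeff (q1 / 20) (q0 / 28) (sqrt 21 * q2 / 84) i j * (mode_scale i * mode_scale j)"
    by (simp add: form_matrix_def)
  show "Q_family q0 q1 q2 $$ (i, j) = form_matrix (family_coeff (q1 / 20) (q0 / 28) (sqrt 21 * q2 / 84)) $$ (i, j)"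
  proof (cases "i \<in> {3, 6, 8, 9} \<and> j \<in> {3, 6, 8, 9}")
    case True
    then show ?thesis
      unfolding form Q_family_index[OF ij]
      by (elim conjE insertE emptyE; hypsubst; simp add: family_coeff_top mode_scale_mult_top;
          simp add: field_simps)
  next
    case False
    have "Q_family q0 q1 q2 $$ (i, j) = 0"
      by (rule Q_family_index_eq_0[OF ij]) (use False in blast)
    moreover have "family_coeff (q1 / 20) (q0 / 28) (sqrt 21 * q2 / 84) i j = 0"
      by (rule family_coeff_eq_0) (use False in blast)
    ultimately show ?thesis
      unfolding form by simp
  qed
qed (simp_all add: form_matrix_def Q_family_def)

lemma extended_range_conditions_iff_Q_family:
  assumes "Q \<in> carrier_mat 10 10"
  shows "extended_range_conditions 3 Q \<longleftrightarrow> (\<exists>q0 q1 q2. Q = Q_family q0 q1 q2)"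
proof -
  obtain B where B: "Q = form_matrix B"
    using form_matrix_surj[OF assms] .
  have "form_matrix (family_coeff p r m) = Q_family (28 * r) (20 * p) (84 * m / sqrt 21)" for p r m
    by (simp add: Q_family_eq_form_matrix)
  then show ?thesis
    unfolding B extended_range_conditions_iff_family_coeff by (metis Q_family_eq_form_matrix)
qed

section \<open>Positive definiteness by blocks of size 2\<close>

lemma binary_quadratic_form_pos_iff:
  fixes a b d :: real
  shows "(\<forall>x y. x \<noteq> 0 \<or> y \<noteq> 0 \<longrightarrow> a * x\<^sup>2 + 2 * b * x * y + d * y\<^sup>2 > 0) \<longleftrightarrow> a > 0 \<and> a * d - b\<^sup>2 > 0"
proof
  assume *: "\<forall>x y. x \<noteq> 0 \<or> y \<noteq> 0 \<longrightarrow> a * x\<^sup>2 + 2 * b * x * y + d * y\<^sup>2 > 0"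
  from *[rule_format, of 1 0] have a: "a > 0"
    by simp
  \<comment> \<open>At the vector (-b, a) the form takes the value \<open>a\<close> times the
    determinant.\<close>
  from *[rule_format, of "- b" a] a have "a * (a * d - b\<^sup>2) > 0"
    by (simp add: algebra_simps power2_eq_square)
  with a show "a > 0 \<and> a * d - b\<^sup>2 > 0"
    by (simp add: zero_less_mult_iff)
next
  assume *: "a > 0 \<and> a * d - b\<^sup>2 > 0"
  show "\<forall>x y. x \<noteq> 0 \<or> y \<noteq> 0 \<longrightarrow> a * x\<^sup>2 + 2 * b * x * y + d * y\<^sup>2 > 0"
  proof (intro allI impI)
    fix x y :: real
    assume xy: "x \<noteq> 0 \<or> y \<noteq> 0"
    have "a * (a * x\<^sup>2 + 2 * b * x * y + d * y\<^sup>2) = (a * x + b * y)\<^sup>2 + (a * d - b\<^sup>2) * y\<^sup>2"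
      by (simp add: algebra_simps power2_eq_square)
    moreover have "(a * x + b * y)\<^sup>2 + (a * d - b\<^sup>2) * y\<^sup>2 > 0"
    proof (cases "y = 0")
      case True
      then show ?thesis
        using * xy by simp
    next
      case False
      then show ?thesis
        using * by (intro add_nonneg_pos) simp_all
    qed
    ultimately show "a * x\<^sup>2 + 2 * b * x * y + d * y\<^sup>2 > 0"
      using * by (metis zero_less_mult_pos)
  qed
qed

lemma Q_family_carrier: "Q_family q0 q1 q2 \<in> carrier_mat 10 10"
  by (simp add: Q_family_def)

lemma Q_family_transpose: "transpose_mat (Q_family q0 q1 q2) = Q_family q0 q1 q2"
  unfolding Q_family_eq_form_matrix
  by (rule eq_matI) (simp_all add: form_matrix_def family_coeff_sym[of _ _ _ "_ :: nat"] mult_ac)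

lemma scalar_prod_mult_Q_family:
  assumes "u \<in> carrier_vec 10"
  shows "u \<bullet> ((1\<^sub>m 10 + Q_family q0 q1 q2) *\<^sub>v u) =
    (\<Sum>i\<in>{0, 1, 2, 4, 5, 7}. (u $ i)\<^sup>2)
    + ((1 + Q_family q0 q1 q2 $$ (3, 3)) * (u $ 3)\<^sup>2 + 2 * Q_family q0 q1 q2 $$ (3, 8) * u $ 3 * u $ 8
       + (1 + Q_family q0 q1 q2 $$ (8, 8)) * (u $ 8)\<^sup>2)
    + ((1 + Q_family q0 q1 q2 $$ (6, 6)) * (u $ 6)\<^sup>2 + 2 * Q_family q0 q1 q2 $$ (6, 9) * u $ 6 * u $ 9
       + (1 + Q_family q0 q1 q2 $$ (9, 9)) * (u $ 9)\<^sup>2)"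
proof -
  define Q where "Q = Q_family q0 q1 q2"
  have Q: "Q \<in> carrier_mat 10 10"
    by (simp add: Q_def Q_family_carrier)
  have "u \<bullet> ((1\<^sub>m 10 + Q) *\<^sub>v u) = u \<bullet> u + u \<bullet> (Q *\<^sub>v u)"
    using assms Q by (simp add: add_mult_distrib_mat_vec[of _ 10 10] scalar_prod_add_distrib[of _ 10])
  also have "u \<bullet> u = (\<Sum>i<10. (u $ i)\<^sup>2)"
    using assms by (simp add: scalar_prod_def atLeast0LessThan power2_eq_square)
  also have "u \<bullet> (Q *\<^sub>v u) = (\<Sum>i<10. u $ i * (\<Sum>j<10. Q $$ (i, j) * u $ j))"
    using assms Q by (simp add: scalar_prod_def atLeast0LessThan)
  also have "\<dots> = (\<Sum>i\<in>{3, 6, 8, 9}. u $ i * (\<Sum>j\<in>{3, 6, 8, 9}. Q $$ (i, j) * u $ j))"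
  proof -
    have "(\<Sum>j<10. Q $$ (i, j) * u $ j) = (\<Sum>j\<in>{3, 6, 8, 9}. Q $$ (i, j) * u $ j)" if "i < 10" for i
      using that by (intro sum.mono_neutral_right) (auto simp: Q_def Q_family_index)
    moreover have "(\<Sum>j<10. Q $$ (i, j) * u $ j) = 0" if "i < 10" "i \<notin> {3, 6, 8, 9}" for i
      using that by (intro sum.neutral) (auto simp: Q_def Q_family_index)
    ultimately show ?thesis
      by (intro sum.mono_neutral_cong_right) (auto simp del: insert_iff simp: insert_iff)
  qed
  finally show ?thesis
    unfolding Q_def[symmetric]
    by (simp add: sum_less_10 Q_def Q_family_index power2_eq_square algebra_simps)
qed

lemma positive_definite_Q_family_iff:
  "positive_definite (1\<^sub>m 10 + Q_family q0 q1 q2) \<longleftrightarrow>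
    (1 + Q_family q0 q1 q2 $$ (3, 3) > 0 \<and>
     (1 + Q_family q0 q1 q2 $$ (3, 3)) * (1 + Q_family q0 q1 q2 $$ (8, 8)) - (Q_family q0 q1 q2 $$ (3, 8))\<^sup>2 > 0) \<and>
    (1 + Q_family q0 q1 q2 $$ (6, 6) > 0 \<and>
     (1 + Q_family q0 q1 q2 $$ (6, 6)) * (1 + Q_family q0 q1 q2 $$ (9, 9)) - (Q_family q0 q1 q2 $$ (6, 9))\<^sup>2 > 0)"
proof -
  define Q where "Q = Q_family q0 q1 q2"
  define f where "f = (\<lambda>x y. (1 + Q $$ (3, 3)) * x\<^sup>2 + 2 * Q $$ (3, 8) * x * y + (1 + Q $$ (8, 8)) * y\<^sup>2)"
  define g where "g = (\<lambda>x y. (1 + Q $$ (6, 6)) * x\<^sup>2 + 2 * Q $$ (6, 9) * x * y + (1 + Q $$ (9, 9)) * y\<^sup>2)"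
  have Q: "Q \<in> carrier_mat 10 10"
    by (simp add: Q_def Q_family_carrier)
  have form: "u \<bullet> ((1\<^sub>m 10 + Q) *\<^sub>v u) = (\<Sum>i\<in>{0, 1, 2, 4, 5, 7}. (u $ i)\<^sup>2) + f (u $ 3) (u $ 8) + g (u $ 6) (u $ 9)"
    if "u \<in> carrier_vec 10" for u
    unfolding Q_def f_def g_def by (rule scalar_prod_mult_Q_family[OF that])
  have "positive_definite (1\<^sub>m 10 + Q) \<longleftrightarrow>
      (\<forall>u \<in> carrier_vec 10. u \<noteq> 0\<^sub>v 10 \<longrightarrow> (\<Sum>i\<in>{0, 1, 2, 4, 5, 7}. (u $ i)\<^sup>2) + f (u $ 3) (u $ 8) + g (u $ 6) (u $ 9) > 0)"
  proof -
    have "transpose_mat (1\<^sub>m 10 + Q) = 1\<^sub>m 10 + Q"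
      using Q by (simp add: transpose_add[of _ 10 10] Q_def Q_family_transpose)
    then show ?thesis
      using Q form unfolding positive_definite_def by auto
  qed
  also have "\<dots> \<longleftrightarrow> (\<forall>x y. x \<noteq> 0 \<or> y \<noteq> 0 \<longrightarrow> f x y > 0) \<and> (\<forall>x y. x \<noteq> 0 \<or> y \<noteq> 0 \<longrightarrow> g x y > 0)"
  proof (intro iffI conjI allI impI ballI)
    fix x y :: real
    assume *: "\<forall>u \<in> carrier_vec 10. u \<noteq> 0\<^sub>v 10 \<longrightarrow>
      (\<Sum>i\<in>{0, 1, 2, 4, 5, 7}. (u $ i)\<^sup>2) + f (u $ 3) (u $ 8) + g (u $ 6) (u $ 9) > 0"
      and xy: "x \<noteq> 0 \<or> y \<noteq> 0"
    \<comment> \<open>A vector supported on the modes of one block isolates the form of that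
      block.\<close>
    define u where "u = vec 10 (\<lambda>i. if i = 3 then x else if i = 8 then y else 0)"
    have "u $ 3 = x" "u $ 8 = y"
      by (simp_all add: u_def)
    then have "u \<noteq> 0\<^sub>v 10"
      using xy by auto
    with * show "f x y > 0"
      by (auto simp: u_def g_def dest!: bspec[of _ _ u])
    define v where "v = vec 10 (\<lambda>i. if i = 6 then x else if i = 9 then y else 0)"
    have "v $ 6 = x" "v $ 9 = y"
      by (simp_all add: v_def)
    then have "v \<noteq> 0\<^sub>v 10"
      using xy by auto
    with * show "g x y > 0"
      by (auto simp: v_def f_def dest!: bspec[of _ _ v])
  next
    fix u :: "real vec"
    assume *: "(\<forall>x y. x \<noteq> 0 \<or> y \<noteq> 0 \<longrightarrow> f x y > 0) \<and> (\<forall>x y. x \<noteq> 0 \<or> y \<noteq> 0 \<longrightarrow> g x y > 0)"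
      and u: "u \<in> carrier_vec 10" "u \<noteq> 0\<^sub>v 10"
    have zero: "f 0 0 = 0" "g 0 0 = 0"
      by (simp_all add: f_def g_def)
    have nonneg: "f x y \<ge> 0" "g x y \<ge> 0" for x y
      using * zero by (metis less_eq_real_def)+
    obtain i where i: "i < 10" "u $ i \<noteq> 0"
      using u by (metis carrier_vecD eq_vecI index_zero_vec(1) index_zero_vec(2))
    consider "i \<in> {0, 1, 2, 4, 5, 7}" | "i \<in> {3, 8}" | "i \<in> {6, 9}"
      using less_10_cases[OF i(1)] by auto
    then show "(\<Sum>i\<in>{0, 1, 2, 4, 5, 7}. (u $ i)\<^sup>2) + f (u $ 3) (u $ 8) + g (u $ 6) (u $ 9) > 0"
    proof cases
      case 1
      then have "(\<Sum>i\<in>{0, 1, 2, 4, 5, 7}. (u $ i)\<^sup>2) > 0"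
        using i by (intro sum_pos2[of _ i]) auto
      then show ?thesis
        using nonneg by (intro add_pos_nonneg) auto
    next
      case 2
      then have "f (u $ 3) (u $ 8) > 0"
        using * i by auto
      then show ?thesis
        using nonneg by (intro add_pos_nonneg add_nonneg_pos sum_nonneg) auto
    next
      case 3
      then have "g (u $ 6) (u $ 9) > 0"
        using * i by auto
      then show ?thesis
        using nonneg by (intro add_nonneg_pos add_nonneg_nonneg sum_nonneg) auto
    qed
  qed
  finally show ?thesis
    unfolding f_def g_def binary_quadratic_form_pos_iff Q_def .
qed

lemma positive_definite_mass_Q_family_iff:
  "positive_definite (mass_matrix 3 + Q_family q0 q1 q2) \<longleftrightarrow>
    28 * q0 + 7 * q1 + 4 * sqrt 21 * q2 > - 35 \<and>
    21 * q0 - 4 * sqrt 21 * q2 > - 21 \<and>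
    (7 * q0 + sqrt 21 * q2 + 7) * (7 * q0 - 42 * q1 + sqrt 21 * q2 - 35) < 0 \<and>
    (7 * q0 + sqrt 21 * q2 + 7) * (3 * q0 - sqrt 21 * q2 + 3) > 0"
proof -
  define s where "s = sqrt 21 * q2"
  have "s\<^sup>2 = 21 * q2\<^sup>2"
    by (simp add: s_def power_mult_distrib)
  then have q2: "q2\<^sup>2 = s\<^sup>2 / 21"
    by simp
  \<comment> \<open>The factors are, up to constants, 1 plus the eigenvalues of the block; the minus
    sign turns the third stability limit into an inequality \<open>< 0\<close>.\<close>
  have det1: "(1 + ((q1 + 4 * q0) / 5 + 4 * s / 35)) * (1 + q1) - ((q0 - q1 + s / 7) / sqrt 5)\<^sup>2
      = - ((7 * q0 + s + 7) * (7 * q0 - 42 * q1 + s - 35)) / 245"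
    by (simp add: power_divide) (simp add: field_simps power2_eq_square)
  have det2: "(1 + (q0 - 4 * s / 21)) * (1 + q0) - q2\<^sup>2 = (7 * q0 + s + 7) * (3 * q0 - s + 3) / 21"
    unfolding q2 by (simp add: field_simps power2_eq_square)
  have lin: "1 + ((q1 + 4 * q0) / 5 + 4 * s / 35) > 0 \<longleftrightarrow> 28 * q0 + 7 * q1 + 4 * s > - 35"
    "1 + (q0 - 4 * s / 21) > 0 \<longleftrightarrow> 21 * q0 - 4 * s > - 21"
    by (auto simp: field_simps)
  have mult: "4 * sqrt 21 * q2 = 4 * s"
    by (simp add: s_def)
  have entries: "Q_family q0 q1 q2 $$ (3, 3) = (q1 + 4 * q0) / 5 + 4 * s / 35"
    "Q_family q0 q1 q2 $$ (3, 8) = (q0 - q1 + s / 7) / sqrt 5"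
    "Q_family q0 q1 q2 $$ (8, 8) = q1"
    "Q_family q0 q1 q2 $$ (6, 6) = q0 - 4 * s / 21"
    "Q_family q0 q1 q2 $$ (6, 9) = q2"
    "Q_family q0 q1 q2 $$ (9, 9) = q0"
    by (simp_all add: Q_family_index s_def)
  show ?thesis
    unfolding mass_matrix_3 positive_definite_Q_family_iff entries det1 det2 lin mult s_def[symmetric]
    by auto
qed

section \<open>The single-parameter scheme\<close>

text \<open>Differentiation lowers the total degree, so a product of three derivative matrices maps the
  modes of degree 3 to multiples of the constant mode and all others to 0.\<close>

definition mode_degree :: "nat \<Rightarrow> nat" where
  "mode_degree i = [0, 1, 2, 3, 1, 2, 3, 2, 3, 3] ! i"

definition degree_lowering :: "(nat \<Rightarrow> nat \<Rightarrow> real) \<Rightarrow> bool" where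
  "degree_lowering A \<longleftrightarrow> (\<forall>i<10. \<forall>j<10. mode_degree j \<le> mode_degree i \<longrightarrow> A i j = 0)"

lemma degree_lowering_dx: "degree_lowering dx_coeff"
  unfolding degree_lowering_def all_less_10
  by (intro conjI; simp add: mode_degree_def dx_coeff_def)

lemma degree_lowering_dt: "degree_lowering (\<lambda>i j. c * dt_coeff i j)"
  unfolding degree_lowering_def all_less_10
  by (intro conjI; simp add: mode_degree_def dt_coeff_def)

text \<open>Along a nonzero product the degree drops strictly three times, starting from at most 3,
  so the degrees are exactly 3, 2, 1, 0. The modes of degree 2 are 2, 5, 7, those of degree 1 are 1
  and 4.\<close>

lemma degree_lowering_mult3:
  assumes "degree_lowering A" "degree_lowering B" "degree_lowering C" "i < 10" "j < 10"
  shows "(\<Sum>l<10. (\<Sum>k<10. A i k * B k l) * C l j) =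
    (if i = 0 then \<Sum>l\<in>{2, 5, 7}. (\<Sum>k\<in>{1, 4}. A 0 k * B k l) * C l j else 0)"
proof -
  have lower: "mode_degree i < mode_degree k" "mode_degree k < mode_degree l" "mode_degree l < mode_degree j"
    if "A i k * B k l * C l j \<noteq> 0" "k < 10" "l < 10" for k l
    using that assms unfolding degree_lowering_def by (metis linorder_not_le mult_eq_0_iff)+
  have bound: "mode_degree j \<le> 3"
    using less_10_cases[OF assms(5)] by (elim disjE; simp add: mode_degree_def)
  have middle: "i = 0 \<and> k \<in> {1, 4} \<and> l \<in> {2, 5, 7}"
    if nz: "A i k * B k l * C l j \<noteq> 0" and kl: "k < 10" "l < 10" for k l
  proof -
    have deg: "mode_degree i = 0" "mode_degree k = 1" "mode_degree l = 2"
      using lower[OF nz kl] bound by linarith+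
    have "i = 0"
      using less_10_cases[OF assms(4)] deg(1) by (elim disjE; simp add: mode_degree_def)
    moreover have "k \<in> {1, 4}"
      using less_10_cases[OF kl(1)] deg(2) by (elim disjE; simp add: mode_degree_def)
    moreover have "l \<in> {2, 5, 7}"
      using less_10_cases[OF kl(2)] deg(3) by (elim disjE; simp add: mode_degree_def)
    ultimately show ?thesis
      by simp
  qed
  have "(\<Sum>l<10. (\<Sum>k<10. A i k * B k l) * C l j) = (\<Sum>l<10. \<Sum>k<10. A i k * B k l * C l j)"
    by (simp only: sum_distrib_right)
  also have "\<dots> = (if i = 0 then \<Sum>l\<in>{2, 5, 7}. \<Sum>k\<in>{1, 4}. A i k * B k l * C l j else 0)"
  proof (cases "i = 0")
    case True
    have inner: "(\<Sum>k<10. A i k * B k l * C l j) = (\<Sum>k\<in>{1, 4}. A i k * B k l * C l j)" if "l < 10" for l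
      by (rule sum.mono_neutral_right) (use middle[OF _ _ that] in auto)
    have outer: "(\<Sum>k<10. A i k * B k l * C l j) = 0" if "l < 10" "l \<notin> {2, 5, 7}" for l
      by (rule sum.neutral) (use middle[OF _ _ that(1)] that(2) in blast)
    have "(\<Sum>l<10. \<Sum>k<10. A i k * B k l * C l j) = (\<Sum>l\<in>{2, 5, 7}. \<Sum>k<10. A i k * B k l * C l j)"
    proof (rule sum.mono_neutral_right)
      show "\<forall>l\<in>{..<10} - {2, 5, 7}. (\<Sum>k<10. A i k * B k l * C l j) = 0"
        using outer by blast
    qed auto
    also have "\<dots> = (\<Sum>l\<in>{2, 5, 7}. \<Sum>k\<in>{1, 4}. A i k * B k l * C l j)"
      by (rule sum.cong[OF refl inner]) auto
    finally have "(\<Sum>l<10. \<Sum>k<10. A i k * B k l * C l j) = (\<Sum>l\<in>{2, 5, 7}. \<Sum>k\<in>{1, 4}. A i k * B k l * C l j)" .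
    then show ?thesis
      using True by simp
  next
    case False
    then have "(\<Sum>l<10. \<Sum>k<10. A i k * B k l * C l j) = 0"
      using middle by (intro sum.neutral ballI) blast
    then show ?thesis
      using False by simp
  qed
  also have "\<dots> = (if i = 0 then \<Sum>l\<in>{2, 5, 7}. (\<Sum>k\<in>{1, 4}. A 0 k * B k l) * C l j else 0)"
    by (simp only: sum_distrib_right cong: if_cong)
  finally show ?thesis .
qed

lemma dx_coeff_chain:
  "dx_coeff 0 (Suc 0) = 0" "dx_coeff 0 4 = 1" "dx_coeff (Suc 0) 2 = 0" "dx_coeff (Suc 0) 5 = 5 / 3" "dx_coeff (Suc 0) 7 = 0"
  "dx_coeff 4 2 = 0" "dx_coeff 4 5 = 0" "dx_coeff 4 7 = 3" "dx_coeff 2 3 = 0" "dx_coeff 2 6 = 21 / 10"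
  "dx_coeff 2 8 = 0" "dx_coeff 2 9 = 1 / 10" "dx_coeff 5 3 = 0" "dx_coeff 5 6 = 0" "dx_coeff 5 8 = 21 / 5"
  "dx_coeff 5 9 = 0" "dx_coeff 7 3 = 0" "dx_coeff 7 6 = 0" "dx_coeff 7 8 = 0" "dx_coeff 7 9 = 5"
  by (simp_all add: dx_coeff_def)

lemma dt_coeff_chain:
  "dt_coeff 0 (Suc 0) = - 3" "dt_coeff 0 4 = 0" "dt_coeff (Suc 0) 2 = - 20 / 3" "dt_coeff (Suc 0) 5 = 0" "dt_coeff (Suc 0) 7 = 1 / 3"
  "dt_coeff 4 2 = 0" "dt_coeff 4 5 = - 5" "dt_coeff 4 7 = 0" "dt_coeff 2 3 = - 21 / 2" "dt_coeff 2 6 = 0"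
  "dt_coeff 2 8 = 7 / 10" "dt_coeff 2 9 = 0" "dt_coeff 5 3 = 0" "dt_coeff 5 6 = - 42 / 5" "dt_coeff 5 8 = 0"
  "dt_coeff 5 9 = 3 / 5" "dt_coeff 7 3 = 0" "dt_coeff 7 6 = 0" "dt_coeff 7 8 = - 7" "dt_coeff 7 9 = 0"
  by (simp_all add: dt_coeff_def)

text \<open>The constant \<open>K_matrix 3 m\<close> assigns to the mode \<open>j\<close>, before normalisation.\<close>

definition third_derivative :: "nat \<Rightarrow> nat \<Rightarrow> real" where
  "third_derivative m j =
    (if (m, j) = (1, 9) then 15
     else if (m, j) = (2, 8) then 21 / sqrt 3
     else if (m, j) = (3, 6) then 14
     else if (m, j) = (3, 9) then - 1
     else if (m, j) = (4, 3) then 70 / sqrt 3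
     else if (m, j) = (4, 8) then - (7 / sqrt 3)
     else 0)"

lemma scaled_matrix_mult3_eqI:
  assumes "degree_lowering A" "degree_lowering B" "degree_lowering C"
    and "\<And>j. j \<in> {3, 6, 8, 9} \<Longrightarrow> (\<Sum>l\<in>{2, 5, 7}. (\<Sum>k\<in>{1, 4}. A 0 k * B k l) * C l j) = v j"
    and "\<And>j. j \<notin> {3, 6, 8, 9} \<Longrightarrow> v j = 0"
  shows "scaled_matrix A * scaled_matrix B * scaled_matrix C = scaled_matrix (\<lambda>i j. if i = 0 then v j else 0)"
  unfolding scaled_matrix_mult
proof (rule scaled_matrix_cong)
  fix i j :: nat
  assume ij: "i < 10" "j < 10"
  have "(\<Sum>l\<in>{2, 5, 7}. (\<Sum>k\<in>{1, 4}. A 0 k * B k l) * C l j) = v j"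
  proof (cases "j \<in> {3, 6, 8, 9}")
    case False
    have "C l j = 0" if "l \<in> {2, 5, 7}" for l
    proof -
      have "mode_degree l = 2" "l < 10"
        using that by (auto simp: mode_degree_def)
      moreover have "mode_degree j \<le> 2"
        using less_10_cases[OF ij(2)] False by (elim disjE; simp add: mode_degree_def)
      ultimately show ?thesis
        using assms(3) ij(2) by (simp add: degree_lowering_def)
    qed
    then show ?thesis
      using assms(5)[OF False] by simp
  qed (rule assms(4))
  then show "(\<Sum>l<10. (\<Sum>k<10. A i k * B k l) * C l j) = (if i = 0 then v j else 0)"
    by (simp only: degree_lowering_mult3[OF assms(1-3) ij])
qed

lemma K_matrix_3:
  assumes "m \<in> {1..4}"
  shows "K_matrix 3 m = scaled_matrix (\<lambda>i j. if i = 0 then third_derivative m j else 0)"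
proof -
  define dy where "dy = (\<lambda>i j. - (1 / sqrt 3) * dt_coeff i j)"
  have X: "D_x 3 = scaled_matrix dx_coeff" "D_x 3 \<in> carrier_mat 10 10"
    and Y: "D_y 3 = scaled_matrix dy" "D_y 3 \<in> carrier_mat 10 10"
    by (simp_all add: D_x_3 D_y_3 dy_def scaled_matrix_def)
  have low: "degree_lowering dx_coeff" "degree_lowering dy"
    unfolding dy_def by (rule degree_lowering_dx degree_lowering_dt)+
  note eval = dx_coeff_chain dt_coeff_chain dy_def third_derivative_def
  have "m = 1 \<or> m = 2 \<or> m = 3 \<or> m = 4"
    using assms by auto
  then show ?thesis
  proof (elim disjE)
    assume m: "m = 1"
    have "K_matrix 3 m = D_x 3 * D_x 3 * D_x 3"
      using X(2) Y(2) by (simp add: K_matrix_def m numeral_eq_Suc)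
    also have "\<dots> = scaled_matrix (\<lambda>i j. if i = 0 then third_derivative m j else 0)"
      unfolding X(1) by (rule scaled_matrix_mult3_eqI[OF low(1) low(1) low(1)]) (auto simp: m eval)
    finally show ?thesis .
  next
    assume m: "m = 2"
    have "K_matrix 3 m = D_x 3 * D_x 3 * D_y 3"
      using X(2) Y(2) by (simp add: K_matrix_def m numeral_eq_Suc)
    also have "\<dots> = scaled_matrix (\<lambda>i j. if i = 0 then third_derivative m j else 0)"
      unfolding X(1) Y(1) by (rule scaled_matrix_mult3_eqI[OF low(1) low(1) low(2)]) (auto simp: m eval)
    finally show ?thesis .
  next
    assume m: "m = 3"
    have "K_matrix 3 m = D_x 3 * D_y 3 * D_y 3"
      using X(2) Y(2) by (simp add: K_matrix_def m numeral_eq_Suc assoc_mult_mat[of _ 10 10 _ 10 _ 10])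
    also have "\<dots> = scaled_matrix (\<lambda>i j. if i = 0 then third_derivative m j else 0)"
      unfolding X(1) Y(1) by (rule scaled_matrix_mult3_eqI[OF low(1) low(2) low(2)]) (auto simp: m eval)
    finally show ?thesis .
  next
    assume m: "m = 4"
    have "K_matrix 3 m = D_y 3 * D_y 3 * D_y 3"
      using X(2) Y(2) by (simp add: K_matrix_def m numeral_eq_Suc)
    also have "\<dots> = scaled_matrix (\<lambda>i j. if i = 0 then third_derivative m j else 0)"
      unfolding Y(1) by (rule scaled_matrix_mult3_eqI[OF low(2) low(2) low(2)]) (auto simp: m eval)
    finally show ?thesis .
  qed
qed

text \<open>Only row 0 of \<open>K_matrix 3 m\<close> is nonzero, and there
  \<open>mode_scale 0 = 1\<close>, so the product is that row times itself.\<close>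

lemma K_matrix_gram:
  assumes "m \<in> {1..4}" "i < 10" "j < 10"
  shows "(transpose_mat (K_matrix 3 m) * mass_matrix 3 * K_matrix 3 m) $$ (i, j)
    = third_derivative m i * third_derivative m j * mode_scale i * mode_scale j"
proof -
  have K: "K_matrix 3 m \<in> carrier_mat 10 10"
    by (simp add: K_matrix_3[OF assms(1)] scaled_matrix_def)
  have "(transpose_mat (K_matrix 3 m) * mass_matrix 3 * K_matrix 3 m) $$ (i, j)
      = (\<Sum>k<10. K_matrix 3 m $$ (k, i) * K_matrix 3 m $$ (k, j))"
    using K assms by (simp add: mass_matrix_3 right_mult_one_mat[of _ 10 10] scalar_prod_def atLeast0LessThan)
  also have "\<dots> = (\<Sum>k<10::nat. if k = 0 then third_derivative m i * third_derivative m j * mode_scale i * mode_scale j else 0)"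
    using assms by (intro sum.cong) (auto simp: K_matrix_3 scaled_matrix_def mode_scale_def)
  finally show ?thesis
    by simp
qed

lemma Q_Castonguay_3:
  "Q_Castonguay 3 c = Q_family (6384 * (c / ref_area)) (27440 * (c / ref_area) / 3) (- 168 * sqrt 21 * (c / ref_area))"
proof -
  define c' where "c' = c / ref_area"
  have range: "{1..3 + 1} = {1, 2, 3, 4 :: nat}"
    by auto
  have binom: "real (3 choose (1 - 1)) = 1" "real (3 choose (2 - 1)) = 3" "real (3 choose (3 - 1)) = 3"
    "real (3 choose (4 - 1)) = 1"
    by (simp_all add: numeral_eq_Suc)
  have "Q_Castonguay 3 c = form_matrix (\<lambda>i j. c' * (\<Sum>m = 1..3 + 1. real (3 choose (m - 1))
      * (third_derivative m i * third_derivative m j)))"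
    unfolding Q_Castonguay_def form_matrix_def num_modes_3 c'_def [symmetric]
    by (rule cong_mat) (auto simp: K_matrix_gram sum_distrib_right mult.assoc intro!: sum.cong)
  \<comment> \<open>From the third derivatives: at \<open>(8, 8)\<close> 3 * 21^2 / 3 + 7^2 / 3 =
    1372 / 3, at \<open>(9, 9)\<close> 15^2 + 3 = 228, at \<open>(6, 9)\<close> 3 * 14 * (-1) =
    -42.\<close>
  also have "\<dots> = form_matrix (family_coeff (1372 / 3 * c') (228 * c') (- 42 * c'))"
  proof (rule form_matrix_cong)
    fix i j :: nat
    have sum: "(\<Sum>m = 1..3 + 1. real (3 choose (m - 1)) * (third_derivative m i * third_derivative m j))
        = third_derivative 1 i * third_derivative 1 j + 3 * (third_derivative 2 i * third_derivative 2 j)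
          + 3 * (third_derivative 3 i * third_derivative 3 j) + third_derivative 4 i * third_derivative 4 j"
      unfolding range using binom by simp
    show "c' * (\<Sum>m = 1..3 + 1. real (3 choose (m - 1)) * (third_derivative m i * third_derivative m j))
        = family_coeff (1372 / 3 * c') (228 * c') (- 42 * c') i j"
    proof (cases "i \<in> {3, 6, 8, 9} \<and> j \<in> {3, 6, 8, 9}")
      case True
      then show ?thesis
        unfolding sum
        by (elim conjE insertE emptyE; hypsubst; simp add: third_derivative_def family_coeff_top)
    next
      case False
      moreover have "third_derivative m k = 0" if "k \<notin> {3, 6, 8, 9}" for m k
        using that by (auto simp: third_derivative_def)
      ultimately have "third_derivative m i * third_derivative m j = 0" for m
        by (metis mult_eq_0_iff)
      moreover have "family_coeff (1372 / 3 * c') (228 * c') (- 42 * c') i j = 0"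
        by (rule family_coeff_eq_0) (use False in blast)
      ultimately show ?thesis
        unfolding sum by (simp only: mult_zero_right add.right_neutral)
    qed
  qed
  also have "\<dots> = Q_family (6384 * c') (27440 * c' / 3) (- 168 * sqrt 21 * c')"
    unfolding Q_family_eq_form_matrix by (simp add: mult.assoc [symmetric])
  finally show ?thesis
    by (simp only: c'_def)
qed

lemma positive_definite_mass_Q_Castonguay_iff:
  "positive_definite (mass_matrix 3 + Q_family (6384 * c) (27440 * c / 3) (- 168 * sqrt 21 * c))
    \<longleftrightarrow> c > - 1 / 9800"
proof -
  have s: "a * sqrt 21 * (- 168 * sqrt 21 * c) = - 3528 * a * c" for a :: real
  proof -
    have "a * sqrt 21 * (- 168 * sqrt 21 * c) = - 168 * a * c * (sqrt 21 * sqrt 21)"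
      by (simp only: mult_ac mult_minus_left mult_minus_right)
    then show ?thesis
      by simp
  qed
  have det1: "(7 * (6384 * c) + - 3528 * c + 7) * (7 * (6384 * c) - 42 * (27440 * c / 3) + - 3528 * c - 35)
      = - 245 * ((1 + 5880 * c) * (1 + 9800 * c))"
    by (simp add: algebra_simps)
  have det2: "(7 * (6384 * c) + - 3528 * c + 7) * (3 * (6384 * c) - - 3528 * c + 3)
      = 21 * ((1 + 5880 * c) * (1 + 7560 * c))"
    by (simp add: algebra_simps)
  have "positive_definite (mass_matrix 3 + Q_family (6384 * c) (27440 * c / 3) (- 168 * sqrt 21 * c)) \<longleftrightarrow>
      28 * (6384 * c) + 7 * (27440 * c / 3) + - 3528 * 4 * c > - 35 \<and>
      21 * (6384 * c) - - 3528 * 4 * c > - 21 \<and>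
      (1 + 5880 * c) * (1 + 9800 * c) > 0 \<and> (1 + 5880 * c) * (1 + 7560 * c) > 0"
    unfolding positive_definite_mass_Q_family_iff s s[of 1, simplified mult_1_left mult_1_right]
    unfolding det1 det2 by (simp add: mult.commute)
  \<comment> \<open>The linear conditions amount to c > -3/19600 and c > -1/7056. Each excludes that
    both factors of the corresponding product are negative, since this would force c < -1/5880. So
    all three factors are positive, and 9800 decides.\<close>
  also have "\<dots> \<longleftrightarrow> c > - 1 / 9800"
    by (auto simp: zero_less_mult_iff)
  finally show ?thesis .
qed

theorem mainTheorem7:
  shows
    "(\<forall>Q \<in> carrier_mat 10 10.
        extended_range_conditions 3 Q \<longleftrightarrow> (\<exists>q0 q1 q2. Q = Q_family q0 q1 q2))
     \<and>
     (\<forall>q0 q1 q2.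
        positive_definite (mass_matrix 3 + Q_family q0 q1 q2) \<longleftrightarrow>
          28 * q0 + 7 * q1 + 4 * sqrt 21 * q2 > - 35 \<and>
          21 * q0 - 4 * sqrt 21 * q2 > - 21 \<and>
          (7 * q0 + sqrt 21 * q2 + 7) * (7 * q0 - 42 * q1 + sqrt 21 * q2 - 35) < 0 \<and>
          (7 * q0 + sqrt 21 * q2 + 7) * (3 * q0 - sqrt 21 * q2 + 3) > 0)
     \<and>
     (\<forall>c c'. c' = c / ref_area \<longrightarrow>
        Q_Castonguay 3 c = Q_family (6384 * c') (27440 * c' / 3) (- 168 * sqrt 21 * c') \<and>
        (positive_definite (mass_matrix 3 + Q_Castonguay 3 c) \<longleftrightarrow> c' > - 1 / 9800))"
proof (intro conjI allI impI ballI)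
  fix Q :: "real mat"
  assume "Q \<in> carrier_mat 10 10"
  then show "extended_range_conditions 3 Q \<longleftrightarrow> (\<exists>q0 q1 q2. Q = Q_family q0 q1 q2)"
    by (rule extended_range_conditions_iff_Q_family)
next
  fix c c' :: real
  assume "c' = c / ref_area"
  then show Q: "Q_Castonguay 3 c = Q_family (6384 * c') (27440 * c' / 3) (- 168 * sqrt 21 * c')"
    by (simp only: Q_Castonguay_3)
  show "positive_definite (mass_matrix 3 + Q_Castonguay 3 c) \<longleftrightarrow> c' > - 1 / 9800"
    unfolding Q by (rule positive_definite_mass_Q_Castonguay_iff)
qed (rule positive_definite_mass_Q_family_iff)

end
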